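(* Let $K$ be a field, $R=K[x_1,\dots,x_n]$, and let $I\subset R$ be a (nonzero proper) monomial ideal without embedded associated primes with minimal irreducible decomposition $I=\mathfrak{q}_1\cap\cdots\cap\mathfrak{q}_r$, where $\mathfrak{q}_j=\langle x_i^{w_{j,i}} : i\in A_j\rangle$ with $A_j\subset[n]$ and $w_{j,i}$ positive integers. Assume that $\mathrm{ht}(\mathfrak{p})=2$ for all $\mathfrak{p}\in\mathrm{Ass}(I)$, and let $G_I$ be the graph on the vertex set $[n]$ with edge set $\{A_1,\dots,A_r\}$. Then the following conditions are equivalent: (i) $I$ is a Simis ideal. (ii) $I^{(2)}=I^2$. (iii) $G_I$ is a bipartite graph and $I$ has a standard linear weighting.
   Context: $[n]=\{1,\dots,n\}$; $\mathbb{N}$ is the set of non-negative integers. For $a\in\mathbb{N}^n$, $x^a=x_1^{a_1}\cdots x_n^{a_n}$. Minimal irreducible decomposition: $I=\mathfrak{q}_1\cap\cdots\cap\mathfrak{q}_r$ where each $\mathfrak{q}_j$ is an irreducible monomial ideal (i.e. of the form $\langle x_i^{w_{j,i}} : i\in A_j\rangle$ with $\emptyset\ne A_j\subset[n]$, $w_{j,i}\ge1$), the radicals $\mathfrak{p}_j=\sqrt{\mathfrak{q}_j}=\langle x_i: i\in A_j\rangle$ are pairwise distinct, and the intersection is irredundant; thus $\mathrm{Ass}(I)=\{\mathfrak{p}_1,\dots,\mathfrak{p}_r\}$. It is assumed that $I$ admits such a decomposition. An embedded prime is an associated prime properly containing another associated prime. Since all associated primes have height 2, each $A_j$ has exactly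 two elements, so $G_I$ is a graph; equivalently $G_I$ is the graph whose cover ideal is $\sqrt{I}$. For $s\ge1$, $I^{(s)}=\bigcap_{\mathfrak{p}\in \mathrm{Ass}(I)}(I^sR_{\mathfrak{p}}\cap R)$. A monomial ideal $I$ is a Simis ideal if $I^{(s)}=I^s$ for all $s\ge1$. A standard linear weighting is a tuple $w=(w_1,\dots,w_n)$ of positive integers, acting by $w(a)=(w_1a_1,\dots,w_na_n)$; for a monomial ideal $J\subset R$, $J_w=\langle x^{w(a)} : x^a\in J\rangle$. $I$ "has a standard linear weighting" if $I=J_w$ for some squarefree monomial ideal $J\subset R$ and some standard linear weighting $w$. *)

theory Defs
  imports
    "HOL-Library.Poly_Mapping"
    "HOL-Library.Extended_Nat"
    "HOL-Computational_Algebra.Fraction_Field"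
    "HOL-Algebra.Ideal_Product"
    "HOL-Algebra.Algebraic_Closure_Type"
begin

section \<open>Ideals of a commutative ring type\<close>

abbreviation ideal_gen :: "'a::comm_ring_1 set \<Rightarrow> 'a set"
  where "ideal_gen S \<equiv> genideal ring_of_type_algebra S"

abbreviation prime_ideal :: "'a::comm_ring_1 set \<Rightarrow> bool"
  where "prime_ideal P \<equiv> primeideal P ring_of_type_algebra"

text \<open>The multiplicative structure of \<^const>\<open>ideals_set\<close> is the monoid of ideals under
  the product of ideals, so its powers are the usual powers of an ideal.\<close>

definition ideal_power :: "'a::comm_ring_1 set \<Rightarrow> nat \<Rightarrow> 'a set"
  where "ideal_power I s = I [^]\<^bsub>ideals_set ring_of_type_algebra\<^esub> s"

definition radical :: "'a::comm_ring_1 set \<Rightarrow> 'a set"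
  where "radical I = {f. \<exists>k\<ge>1. f ^ k \<in> I}"

text \<open>\<open>Ass(I)\<close> stands for the set of associated primes of the module \<open>R/I\<close>: those primes that are
  the annihilator \<open>(I : f)\<close> of the class of some ring element \<open>f\<close>.\<close>

definition associated_primes :: "'a::comm_ring_1 set \<Rightarrow> 'a set set"
  where "associated_primes I = {P. prime_ideal P \<and> (\<exists>f. P = {g. g * f \<in> I})}"

definition embedded_primes :: "'a::comm_ring_1 set \<Rightarrow> 'a set set"
  where "embedded_primes I =
    {P \<in> associated_primes I. \<exists>Q \<in> associated_primes I. Q \<subset> P}"

definition height :: "'a::comm_ring_1 set \<Rightarrow> enat"
  where "height P = Sup {enat k | k. \<exists>C :: nat \<Rightarrow> 'a set.
    (\<forall>i\<le>k. prime_ideal (C i)) \<and> (\<forall>i<k. C i \<subset> C (Suc i)) \<and> C k = P}"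

section \<open>Localization and symbolic powers\<close>

text \<open>For a prime \<open>P\<close> of a domain \<open>R\<close>, the localization \<open>R\<^sub>P\<close> is taken as a subring of the fraction
  field of \<open>R\<close>. A prime contains \<open>0\<close>, so the denominators below are nonzero.\<close>

definition localization :: "'a::idom set \<Rightarrow> 'a fract ring"
  where "localization P =
    (ring_of_type_algebra :: 'a fract ring)
      \<lparr>carrier := {Fraction_Field.Fract a b | a b. b \<notin> P}\<rparr>"

definition local_embed :: "'a::idom \<Rightarrow> 'a fract"
  where "local_embed f = Fraction_Field.Fract f 1"

text \<open>The ideal \<open>I R\<^sub>P\<close> of \<open>R\<^sub>P\<close>, and its contraction \<open>I R\<^sub>P \<inter> R\<close>.\<close>

definition local_extension :: "'a::idom set \<Rightarrow> 'a set \<Rightarrow> 'a fract set"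
  where "local_extension P I = genideal (localization P) (local_embed ` I)"

definition local_contraction :: "'a::idom set \<Rightarrow> 'a set \<Rightarrow> 'a set"
  where "local_contraction P I = {f. local_embed f \<in> local_extension P I}"

definition symbolic_power :: "'a::idom set \<Rightarrow> nat \<Rightarrow> 'a set"
  where "symbolic_power I s =
    (\<Inter>P \<in> associated_primes I. local_contraction P (ideal_power I s))"

section \<open>Monomial ideals in a polynomial ring\<close>

text \<open>Polynomials over \<open>'k\<close> in the finitely many variables indexed by \<open>'n\<close>.\<close>

type_synonym ('n, 'k) mpoly = "('n \<Rightarrow>\<^sub>0 nat) \<Rightarrow>\<^sub>0 'k"

definition var :: "'n \<Rightarrow> ('n, 'k::comm_ring_1) mpoly"
  where "var i = Poly_Mapping.single (Poly_Mapping.single i 1) 1"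

definition xpow :: "('n::finite \<Rightarrow> nat) \<Rightarrow> ('n, 'k::comm_ring_1) mpoly"
  where "xpow a = (\<Prod>i\<in>UNIV. var i ^ a i)"

definition monomial_ideal :: "('n::finite, 'k::field) mpoly set \<Rightarrow> bool"
  where "monomial_ideal I \<longleftrightarrow> (\<exists>S. I = ideal_gen (xpow ` S))"

definition squarefree_monomial_ideal :: "('n::finite, 'k::field) mpoly set \<Rightarrow> bool"
  where "squarefree_monomial_ideal J \<longleftrightarrow>
    (\<exists>S. (\<forall>a\<in>S. \<forall>i. a i \<le> 1) \<and> J = ideal_gen (xpow ` S))"

definition weighted_ideal ::
    "('n::finite \<Rightarrow> nat) \<Rightarrow> ('n, 'k::field) mpoly set \<Rightarrow> ('n, 'k) mpoly set"
  where "weighted_ideal w J = ideal_gen {xpow (\<lambda>i. w i * a i) | a. xpow a \<in> J}"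

definition has_standard_linear_weighting :: "('n::finite, 'k::field) mpoly set \<Rightarrow> bool"
  where "has_standard_linear_weighting I \<longleftrightarrow>
    (\<exists>J w. squarefree_monomial_ideal J \<and> (\<forall>i. 0 < w i) \<and> I = weighted_ideal w J)"

definition irreducible_component :: "'n set \<Rightarrow> ('n \<Rightarrow> nat) \<Rightarrow> ('n::finite, 'k::field) mpoly set"
  where "irreducible_component A w = ideal_gen ((\<lambda>i. var i ^ w i) ` A)"

definition minimal_irreducible_decomposition ::
    "('n::finite, 'k::field) mpoly set \<Rightarrow> nat \<Rightarrow> (nat \<Rightarrow> 'n set) \<Rightarrow> (nat \<Rightarrow> 'n \<Rightarrow> nat) \<Rightarrow> bool"
  where "minimal_irreducible_decomposition I r A w \<longleftrightarrow>
    (\<forall>j\<in>{1..r}. A j \<noteq> {} \<and> (\<forall>i\<in>A j. 1 \<le> w j i)) \<and>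
    I = (\<Inter>j\<in>{1..r}. irreducible_component (A j) (w j)) \<and>
    inj_on (\<lambda>j. radical (irreducible_component (A j) (w j) :: ('n, 'k) mpoly set)) {1..r} \<and>
    (\<forall>k\<in>{1..r}. I \<noteq> (\<Inter>j\<in>{1..r} - {k}. irreducible_component (A j) (w j)))"

definition simis_ideal :: "('n::{finite,linorder}, 'k::field) mpoly set \<Rightarrow> bool"
  where "simis_ideal I \<longleftrightarrow>
    monomial_ideal I \<and> (\<forall>s\<ge>1. symbolic_power I s = ideal_power I s)"

section \<open>Bipartite graphs\<close>

definition bipartite :: "'v set \<Rightarrow> 'v set set \<Rightarrow> bool"
  where "bipartite V E \<longleftrightarrow>
    (\<exists>U W. U \<union> W = V \<and> U \<inter> W = {} \<and> (\<forall>e\<in>E. \<exists>u\<in>U. \<exists>v\<in>W. e = {u, v}))"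

end

theory Submission
  imports Defs "HOL-Algebra.Subrings"
begin

text \<open>
  Each \<open>I\<^sup>s\<close> and each \<open>I\<^sup>(\<^sup>s\<^sup>)\<close> is spanned by monomials, so the theorem is a statement about sets of
  exponent vectors: localizing at \<open>p\<^sub>j\<close> inverts the variables outside \<open>A\<^sub>j\<close>, which gives
  \<open>I\<^sup>(\<^sup>s\<^sup>) = q\<^sub>1\<^sup>s \<inter> \<dots> \<inter> q\<^sub>r\<^sup>s\<close>. A chain of primes generated by variables bounds the height
  of \<open>p\<^sub>j\<close> from below by \<open>|A\<^sub>j|\<close>, and \<open>(x\<^sub>i)\<close> has height at most one, so every \<open>A\<^sub>j\<close> is an edge.

  Suppose \<open>I\<^sup>(\<^sup>2\<^sup>) = I\<^sup>2\<close>. Splitting suitable monomials of \<open>I\<^sup>(\<^sup>2\<^sup>)\<close> in the variables of two adjacent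
  edges forces the weights of the edges at a vertex to agree. Then \<open>\<Prod> x\<^sub>i\<^bsup>w\<^sub>i\<^esup> \<in> I\<^sup>(\<^sup>2\<^sup>)\<close> splits into two
  disjoint vertex covers, which form a bipartition. Conversely, with global weights and a
  bipartition, an exponent vector of \<open>I\<^sup>(\<^sup>s\<^sup>)\<close> dominates an explicit sum of \<open>s\<close> weighted vertex covers.
\<close>

section \<open>Ideals, localization and height\<close>

lemma type_algebra_simps [simp]:
  "carrier (ring_of_type_algebra :: 'a::comm_ring_1 ring) = UNIV"
  "x \<otimes>\<^bsub>ring_of_type_algebra :: 'a ring\<^esub> y = x * y"
  "x \<oplus>\<^bsub>ring_of_type_algebra :: 'a ring\<^esub> y = x + y"
  "\<one>\<^bsub>ring_of_type_algebra :: 'a ring\<^esub> = 1"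
  "\<zero>\<^bsub>ring_of_type_algebra :: 'a ring\<^esub> = 0"
  by (simp_all add: ring_of_type_algebra_def)

lemma a_inv_type_algebra [simp]:
  "\<ominus>\<^bsub>ring_of_type_algebra\<^esub> x = - (x :: 'a::comm_ring_1)"
proof -
  interpret ring "ring_of_type_algebra :: 'a ring" by (rule ring_from_type_algebra)
  show ?thesis
    using minus_equality[of "- x" x] by simp
qed

lemma ring_type_algebra_carrier:
  fixes K :: "'a::comm_ring_1 set"
  assumes "1 \<in> K" "\<And>x. x \<in> K \<Longrightarrow> - x \<in> K"
    and "\<And>x y. x \<in> K \<Longrightarrow> y \<in> K \<Longrightarrow> x * y \<in> K" "\<And>x y. x \<in> K \<Longrightarrow> y \<in> K \<Longrightarrow> x + y \<in> K"
  shows "ring (ring_of_type_algebra \<lparr>carrier := K\<rparr>)"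
proof -
  interpret ring "ring_of_type_algebra :: 'a ring" by (rule ring_from_type_algebra)
  show ?thesis
    by (rule subring_is_ring, rule subringI) (use assms in auto)
qed

text \<open>The carrier \<open>K\<close> stays free so that one criterion serves both the polynomial
  ring and a localization inside its fraction field. Closure under negation follows on multiplying
  by the additive inverse of one, which lies in \<open>K\<close>.\<close>

lemma ideal_type_algebra_carrierI:
  fixes K :: "'a::comm_ring_1 set"
  assumes R: "ring (ring_of_type_algebra \<lparr>carrier := K\<rparr>)"
    and J: "J \<subseteq> K" "0 \<in> J" "\<And>a b. a \<in> J \<Longrightarrow> b \<in> J \<Longrightarrow> a + b \<in> J"
      "\<And>x a. x \<in> K \<Longrightarrow> a \<in> J \<Longrightarrow> x * a \<in> J"
  shows "ideal J (ring_of_type_algebra \<lparr>carrier := K\<rparr>)"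
proof (rule idealI[OF R])
  interpret ring "ring_of_type_algebra \<lparr>carrier := K\<rparr>" by (rule R)
  have neg: "\<ominus>\<^bsub>ring_of_type_algebra \<lparr>carrier := K\<rparr>\<^esub> a \<in> J" if "a \<in> J" for a
  proof -
    have "\<ominus>\<^bsub>ring_of_type_algebra \<lparr>carrier := K\<rparr>\<^esub> a
      = (\<ominus>\<^bsub>ring_of_type_algebra \<lparr>carrier := K\<rparr>\<^esub> \<one>\<^bsub>ring_of_type_algebra \<lparr>carrier := K\<rparr>\<^esub>)
        \<otimes>\<^bsub>ring_of_type_algebra \<lparr>carrier := K\<rparr>\<^esub> a"
      using that J(1) l_minus[of "\<one>\<^bsub>ring_of_type_algebra \<lparr>carrier := K\<rparr>\<^esub>" a] l_one[of a] one_closed by auto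
    also have "\<dots> = (\<ominus>\<^bsub>ring_of_type_algebra \<lparr>carrier := K\<rparr>\<^esub> \<one>\<^bsub>ring_of_type_algebra \<lparr>carrier := K\<rparr>\<^esub>) * a"
      by simp
    also have "\<dots> \<in> J"
      using J(4)[OF _ that] a_inv_closed[OF one_closed] by simp
    finally show ?thesis .
  qed
  show "subgroup J (add_monoid (ring_of_type_algebra \<lparr>carrier := K\<rparr>))"
    by (rule add.subgroupI) (use J neg in \<open>auto simp: a_inv_def\<close>)
  show "a \<otimes>\<^bsub>ring_of_type_algebra \<lparr>carrier := K\<rparr>\<^esub> x \<in> J"
    if "a \<in> J" "x \<in> carrier (ring_of_type_algebra \<lparr>carrier := K\<rparr>)" for a x
    using J(4)[of x a] that by (simp add: mult.commute)
qed (use J in auto)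

lemma type_algebra_carrier_UNIV:
  "ring_of_type_algebra \<lparr>carrier := UNIV\<rparr> = (ring_of_type_algebra :: 'a::comm_ring_1 ring)"
  by (simp add: ring_of_type_algebra_def)

lemma ideal_type_algebraI:
  fixes J :: "'a::comm_ring_1 set"
  assumes "0 \<in> J" "\<And>a b. a \<in> J \<Longrightarrow> b \<in> J \<Longrightarrow> a + b \<in> J" "\<And>x a. a \<in> J \<Longrightarrow> x * a \<in> J"
  shows "ideal J ring_of_type_algebra"
  using ideal_type_algebra_carrierI[of UNIV J] assms
  by (simp add: type_algebra_carrier_UNIV ring_from_type_algebra)

lemma ideal_type_algebra_carrierD:
  fixes J K :: "'a::comm_ring_1 set"
  assumes "ideal J (ring_of_type_algebra \<lparr>carrier := K\<rparr>)"
  shows "0 \<in> J" "\<And>a b. a \<in> J \<Longrightarrow> b \<in> J \<Longrightarrow> a + b \<in> J" "\<And>x a. x \<in> K \<Longrightarrow> a \<in> J \<Longrightarrow> x * a \<in> J"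
proof -
  interpret ideal J "ring_of_type_algebra \<lparr>carrier := K\<rparr>" by (rule assms)
  show "0 \<in> J" using additive_subgroup.zero_closed[OF additive_subgroup_axioms] by simp
  show "a + b \<in> J" if "a \<in> J" "b \<in> J" for a b
    using additive_subgroup.a_closed[OF additive_subgroup_axioms] that by simp
  show "x * a \<in> J" if "x \<in> K" "a \<in> J" for x a
    using I_l_closed[of a x] that by simp
qed

lemmas ideal_type_algebraD =
  ideal_type_algebra_carrierD[of _ UNIV, unfolded type_algebra_carrier_UNIV, simplified]

lemma ideal_gen_least:
  fixes J :: "'a::comm_ring_1 set"
  assumes "ideal J ring_of_type_algebra" "S \<subseteq> J"
  shows "ideal_gen S \<subseteq> J"
  using ring.genideal_minimal[OF ring_from_type_algebra assms] .

lemma ideal_ideal_gen: "ideal (ideal_gen S) (ring_of_type_algebra :: 'a::comm_ring_1 ring)"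
  using ring.genideal_ideal[OF ring_from_type_algebra] by simp

lemma ideal_gen_superset: "S \<subseteq> ideal_gen (S :: 'a::comm_ring_1 set)"
  using ring.genideal_self[OF ring_from_type_algebra] by simp

lemma ideal_gen_singleton: "ideal_gen {x} = {y * x | y. True}" for x :: "'a::comm_ring_1"
  using cring.cgenideal_eq_genideal[OF cring_from_type_algebra, of x]
  by (auto simp: cgenideal_def)

lemma prime_idealI:
  fixes P :: "'a::comm_ring_1 set"
  assumes "ideal P ring_of_type_algebra" "1 \<notin> P" "\<And>a b. a * b \<in> P \<Longrightarrow> a \<in> P \<or> b \<in> P"
  shows "prime_ideal P"
  using assms by (intro primeidealI) auto

lemma prime_idealD:
  fixes P :: "'a::comm_ring_1 set"
  assumes "prime_ideal P"
  shows "ideal P ring_of_type_algebra" "1 \<notin> P" "\<And>a b. a * b \<in> P \<Longrightarrow> a \<in> P \<or> b \<in> P"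
proof -
  interpret primeideal P ring_of_type_algebra by (rule assms)
  show "ideal P ring_of_type_algebra" by (rule is_ideal)
  show "1 \<notin> P" using I_notcarr one_imp_carrier by auto
  show "a \<in> P \<or> b \<in> P" if "a * b \<in> P" for a b using I_prime[of a b] that by auto
qed

lemma prime_ideal_prod:
  fixes P :: "'a::comm_ring_1 set"
  assumes "prime_ideal P" "finite T" "\<And>t. t \<in> T \<Longrightarrow> f t \<notin> P"
  shows "prod f T \<notin> P"
  using assms(2,3) by (induction T) (use prime_idealD[OF assms(1)] in auto)

lemma prime_ideal_power:
  fixes P :: "'a::comm_ring_1 set"
  assumes "prime_ideal P" "f \<notin> P"
  shows "f ^ k \<notin> P"
  using prime_ideal_prod[OF assms(1), of "{..<k}" "\<lambda>_. f"] assms(2) by simp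

section \<open>Powers of ideals and contraction from a localization\<close>

lemma ideal_power_0 [simp]: "ideal_power I 0 = (UNIV :: 'a::comm_ring_1 set)"
  by (simp add: ideal_power_def ideals_set_def nat_pow_def)

lemma ideal_power_Suc [simp]:
  "ideal_power I (Suc s) = ideal_prod ring_of_type_algebra (ideal_power I s) (I :: 'a::comm_ring_1 set)"
  by (simp add: ideal_power_def ideals_set_def nat_pow_def)

text \<open>The extension of \<open>L\<close> consists of the fractions with numerator in
  \<open>L\<close> and denominator outside \<open>P\<close>. Clearing denominators in
  \<open>f/1 = a/b\<close> describes the contraction inside the ring itself, so no fractions occur
  after this lemma.\<close>

lemma local_contraction_eq:
  fixes P L :: "'a::idom set"
  assumes P: "prime_ideal P" and L: "ideal L ring_of_type_algebra"
  shows "local_contraction P L = {f. \<exists>h. h \<notin> P \<and> h * f \<in> L}"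
proof -
  note Pd = prime_idealD[OF P] and Ld = ideal_type_algebraD[OF L]
  have P0: "0 \<in> P" using ideal_type_algebraD[OF Pd(1)] by blast
  have nz: "b \<noteq> 0" if "b \<notin> P" for b using that P0 by auto
  define K where "K = {Fraction_Field.Fract a b | a b. b \<notin> P}"
  define E where "E = {Fraction_Field.Fract a b | a b. a \<in> L \<and> b \<notin> P}"
  have loc: "localization P = ring_of_type_algebra \<lparr>carrier := K\<rparr>"
    by (simp add: localization_def K_def)
  have mul: "b * d \<notin> P" if "b \<notin> P" "d \<notin> P" for b d using Pd(3) that by blast
  have ring: "ring (ring_of_type_algebra \<lparr>carrier := K\<rparr>)"
  proof (rule ring_type_algebra_carrier)
    show "1 \<in> K" unfolding K_def One_fract_def using Pd(2) by blast
    show "- x \<in> K" if "x \<in> K" for x using that unfolding K_def by (auto; metis)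
    show "x * y \<in> K" if "x \<in> K" "y \<in> K" for x y
      using that mul unfolding K_def by (auto; blast)
    show "x + y \<in> K" if xy: "x \<in> K" "y \<in> K" for x y
    proof -
      obtain a b c d where "x = Fraction_Field.Fract a b" "b \<notin> P" "y = Fraction_Field.Fract c d" "d \<notin> P"
        using xy unfolding K_def by blast
      then have "x + y = Fraction_Field.Fract (a * d + c * b) (b * d)" "b * d \<notin> P"
        using nz mul by auto
      then show ?thesis unfolding K_def by blast
    qed
  qed
  have idE: "ideal E (ring_of_type_algebra \<lparr>carrier := K\<rparr>)"
  proof (rule ideal_type_algebra_carrierI[OF ring])
    show "E \<subseteq> K" unfolding E_def K_def by blast
    show "0 \<in> E" unfolding E_def Zero_fract_def using Pd(2) Ld(1) by blast
    show "x + y \<in> E" if xy: "x \<in> E" "y \<in> E" for x y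
    proof -
      obtain a b c d where *: "x = Fraction_Field.Fract a b" "b \<notin> P" "y = Fraction_Field.Fract c d" "d \<notin> P"
        "a \<in> L" "c \<in> L"
        using xy unfolding E_def by blast
      then have "x + y = Fraction_Field.Fract (a * d + c * b) (b * d)" "b * d \<notin> P"
        using nz mul by auto
      moreover have "a * d + c * b \<in> L"
        using Ld(2)[OF Ld(3)[OF *(5), of d] Ld(3)[OF *(6), of b]] by (simp add: mult.commute)
      ultimately show ?thesis unfolding E_def by blast
    qed
    show "x * y \<in> E" if xy: "x \<in> K" "y \<in> E" for x y
    proof -
      obtain a b c d where *: "x = Fraction_Field.Fract a b" "b \<notin> P" "y = Fraction_Field.Fract c d" "d \<notin> P"
        "c \<in> L"
        using xy unfolding E_def K_def by blast
      then have "x * y = Fraction_Field.Fract (a * c) (b * d)" "b * d \<notin> P" "a * c \<in> L"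
        using mul Ld by auto
      then show ?thesis unfolding E_def by blast
    qed
  qed
  have "local_embed ` L \<subseteq> E"
    unfolding E_def local_embed_def using Pd(2) by blast
  have ext: "local_extension P L = E"
  proof
    show "local_extension P L \<subseteq> E"
      unfolding local_extension_def loc
      by (rule ring.genideal_minimal[OF ring idE]) fact
    show "E \<subseteq> local_extension P L"
    proof
      fix x assume "x \<in> E"
      then obtain a b where x: "x = Fraction_Field.Fract a b" "a \<in> L" "b \<notin> P" unfolding E_def by blast
      have emb: "local_embed ` L \<subseteq> K"
        unfolding K_def local_embed_def using Pd(2) by blast
      have "local_embed ` L \<subseteq> local_extension P L"
        unfolding local_extension_def loc by (rule ring.genideal_self[OF ring]) (use emb in simp)
      moreover have "ideal (local_extension P L) (ring_of_type_algebra \<lparr>carrier := K\<rparr>)"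
        unfolding local_extension_def loc by (rule ring.genideal_ideal[OF ring]) (use emb in simp)
      moreover have "Fraction_Field.Fract 1 b \<in> K" unfolding K_def using x by blast
      ultimately have "Fraction_Field.Fract 1 b * local_embed a \<in> local_extension P L"
        using ideal_type_algebra_carrierD(3) x(2) by blast
      then show "x \<in> local_extension P L" by (simp add: x local_embed_def)
    qed
  qed
  show ?thesis
  proof (intro equalityI subsetI; clarsimp simp: local_contraction_def ext)
    fix f assume "local_embed f \<in> E"
    then obtain a b where "Fraction_Field.Fract f 1 = Fraction_Field.Fract a b" "a \<in> L" "b \<notin> P"
      unfolding E_def local_embed_def by blast
    then have "b * f = a" using nz by (simp add: eq_fract mult.commute)
    then show "\<exists>h. h \<notin> P \<and> h * f \<in> L" using \<open>a \<in> L\<close> \<open>b \<notin> P\<close> by auto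
  next
    fix f h assume "h \<notin> P" "h * f \<in> L"
    moreover have "local_embed f = Fraction_Field.Fract (h * f) h"
      using nz[OF \<open>h \<notin> P\<close>] by (simp add: local_embed_def eq_fract)
    ultimately show "local_embed f \<in> E" unfolding E_def by blast
  qed
qed

section \<open>Bounds on the height of a prime\<close>

lemma chain_length_le_height:
  assumes "\<And>i. i \<le> k \<Longrightarrow> prime_ideal (C i)" "\<And>i. i < k \<Longrightarrow> C i \<subset> C (Suc i)" "C k = P"
  shows "enat k \<le> height (P :: 'a::comm_ring_1 set)"
  unfolding height_def by (rule Sup_upper) (use assms in blast)

text \<open>The step \<open>Q \<subset> (x)\<close> of a chain puts \<open>Q\<close> inside every power of \<open>x\<close>: if \<open>g x \<in> Q\<close>, then
  \<open>g \<in> Q\<close> since \<open>x \<notin> Q\<close>.\<close>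

lemma height_principal_le_1:
  fixes x :: "'a::comm_ring_1"
  assumes inter: "\<And>f. (\<And>k. x ^ k dvd f) \<Longrightarrow> f = 0"
  shows "height (ideal_gen {x}) \<le> 1"
proof -
  have pr: "ideal_gen {x} = {f. x dvd f}"
    unfolding ideal_gen_singleton by (auto simp: dvd_def mult.commute)
  have "k \<le> 1" if C: "\<forall>i\<le>k. prime_ideal (C i)" "\<forall>i<k. C i \<subset> C (Suc i)" "C k = ideal_gen {x}"
    for k and C :: "nat \<Rightarrow> 'a set"
  proof (rule ccontr)
    assume "\<not> k \<le> 1"
    \<comment> \<open>A chain of length at least 2 ends in
      \<open>C m \<subset> Q \<subset> (x)\<close>. It suffices that \<open>Q\<close> is zero, which
      leaves no room for \<open>C m\<close>.\<close>
    moreover define m where "m = k - 2"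
    ultimately have k: "k = Suc (Suc m)" by simp
    define Q where "Q = C (Suc m)"
    have Q: "prime_ideal Q" "Q \<subset> {f. x dvd f}" and C0: "prime_ideal (C m)" "C m \<subset> Q"
      using C unfolding k Q_def pr by auto
    note Qd = prime_idealD[OF Q(1)]
    have xQ: "x \<notin> Q"
    proof
      assume "x \<in> Q"
      then have "{f. x dvd f} \<subseteq> Q"
        using ideal_type_algebraD(3)[OF Qd(1) \<open>x \<in> Q\<close>] by (auto simp: dvd_def mult.commute[of x])
      then show False using Q(2) by blast
    qed
    have dvd: "\<forall>f\<in>Q. x ^ j dvd f" for j
    proof (induction j)
      case (Suc j)
      show ?case
      proof
        fix f assume f: "f \<in> Q"
        then obtain g where g: "f = x * g" using Q(2) by (auto elim: dvdE)
        then have "g \<in> Q" using Qd(3) f xQ by blast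
        then show "x ^ Suc j dvd f" using Suc g by (simp add: mult_dvd_mono)
      qed
    qed simp
    have "Q \<subseteq> {0}" using inter dvd by blast
    moreover have "0 \<in> C m" using ideal_type_algebraD(1) prime_idealD(1) C0(1) by blast
    ultimately show False using C0(2) by blast
  qed
  then show ?thesis
    unfolding height_def by (intro Sup_least) (auto simp: one_enat_def)
qed

section \<open>Spans of monomials\<close>

text \<open>Exponent vectors are plain functions, so that divisibility of monomials becomes the
  pointwise order.\<close>

definition support :: "('n, 'k::zero) mpoly \<Rightarrow> ('n \<Rightarrow> nat) set"
  where "support f = Poly_Mapping.lookup ` Poly_Mapping.keys f"

definition monomial_span :: "('n \<Rightarrow> nat) set \<Rightarrow> ('n, 'k::zero) mpoly set"
  where "monomial_span M = {f. support f \<subseteq> M}"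

definition up_closed :: "('n \<Rightarrow> nat) set \<Rightarrow> bool"
  where "up_closed M \<longleftrightarrow> (\<forall>a\<in>M. \<forall>b. a \<le> b \<longrightarrow> b \<in> M)"

text \<open>For \<open>up_closed M\<close> these are the exponents of the powers of the monomial
  ideal of \<open>M\<close>. The base case reflects that the zeroth power is the whole ring, and the
  inequality keeps every stage closed upwards.\<close>

primrec power_set :: "('n \<Rightarrow> nat) set \<Rightarrow> nat \<Rightarrow> ('n \<Rightarrow> nat) set"
  where
    "power_set M 0 = UNIV"
  | "power_set M (Suc s) = {a. \<exists>b\<in>power_set M s. \<exists>c\<in>M. \<forall>i. b i + c i \<le> a i}"

lemma up_closedD: "up_closed M \<Longrightarrow> a \<in> M \<Longrightarrow> (\<And>i. a i \<le> b i) \<Longrightarrow> b \<in> M"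
  unfolding up_closed_def le_fun_def by blast

lemma up_closed_power_set: "up_closed (power_set M s)"
  by (cases s) (auto simp: up_closed_def le_fun_def, meson le_trans)

lemma up_closed_INT: "(\<And>j. j \<in> T \<Longrightarrow> up_closed (M j)) \<Longrightarrow> up_closed (\<Inter>j\<in>T. M j)"
  unfolding up_closed_def by blast

lemma power_set_mono: "M \<subseteq> N \<Longrightarrow> power_set M s \<subseteq> power_set N s"
  by (induction s) (auto; blast)+

lemma sum_in_power_set:
  assumes "\<And>t. t < s \<Longrightarrow> b t \<in> M" "\<And>i. (\<Sum>t<s. b t i) \<le> a i"
  shows "a \<in> power_set M s"
  using assms
proof (induction s arbitrary: a)
  case (Suc s)
  have "(\<lambda>i. \<Sum>t<s. b t i) \<in> power_set M s"
    by (rule Suc.IH) (use Suc.prems in auto)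
  moreover have "\<forall>i. (\<Sum>t<s. b t i) + b s i \<le> a i" using Suc.prems(2) by simp
  ultimately show ?case using Suc.prems(1)[of s] by (auto intro!: bexI)
qed simp

lemma finite_support [simp]: "finite (support f)"
  by (simp add: support_def)

lemma support_0 [simp]: "support 0 = {}"
  by (simp add: support_def)

lemma support_eq_empty [simp]: "support f = {} \<longleftrightarrow> f = 0"
  by (auto simp: support_def poly_mapping_eqI in_keys_iff intro: poly_mapping_eqI)

lemma support_add: "support (f + g) \<subseteq> support f \<union> support g"
  using Poly_Mapping.keys_add[of f g] by (auto simp: support_def)

lemma support_uminus [simp]: "support (- f) = support (f :: ('n, 'k::ab_group_add) mpoly)"
  by (auto simp: support_def in_keys_iff)

lemma support_minus: "support (f - g) \<subseteq> support f \<union> support (g :: ('n, 'k::ab_group_add) mpoly)"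
  using support_add[of f "- g"] by simp

lemma support_mult:
  assumes "c \<in> support (f * g)"
  obtains a b where "a \<in> support f" "b \<in> support g" "c = (\<lambda>i. a i + b i)"
proof -
  obtain k where k: "k \<in> Poly_Mapping.keys (f * g)" "c = Poly_Mapping.lookup k"
    using assms by (auto simp: support_def)
  then obtain a b where "a \<in> Poly_Mapping.keys f" "b \<in> Poly_Mapping.keys g" "k = a + b"
    using Poly_Mapping.keys_mult[of f g] by blast
  then show ?thesis using that[of "Poly_Mapping.lookup a" "Poly_Mapping.lookup b"] k(2)
    by (auto simp: support_def lookup_add fun_eq_iff)
qed

lemma xpow_eq_single:
  "xpow a = (Poly_Mapping.single (Abs_poly_mapping a) 1 :: ('n::finite, 'k::comm_ring_1) mpoly)"
proof -
  have pw: "var i ^ m = (Poly_Mapping.single (Poly_Mapping.single i m) 1 :: ('n, 'k) mpoly)" for i :: 'n and m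
    by (induction m) (simp_all add: var_def mult_single single_add[symmetric])
  have pr: "(\<Prod>i\<in>T. var i ^ a i) = (Poly_Mapping.single (\<Sum>i\<in>T. Poly_Mapping.single i (a i)) 1 :: ('n, 'k) mpoly)"
    if "finite T" for T :: "'n set"
    using that by induction (simp_all add: pw mult_single)
  have "(\<Sum>i\<in>UNIV. Poly_Mapping.single i (a i)) = Abs_poly_mapping a"
    by (rule poly_mapping_eqI)
      (simp add: lookup_sum lookup_single when_def Abs_poly_mapping_inverse sum.delta)
  then show ?thesis unfolding xpow_def using pr[of UNIV] by simp
qed

lemma support_xpow [simp]: "support (xpow a :: ('n::finite, 'k::comm_ring_1) mpoly) = {a}"
  by (simp add: xpow_eq_single support_def Abs_poly_mapping_inverse)

lemma support_1 [simp]: "support (1 :: ('n, 'k::comm_ring_1) mpoly) = {\<lambda>_. 0}"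
  by (simp add: support_def fun_eq_iff)

lemma xpow_mult: "xpow a * xpow b = xpow (\<lambda>i. a i + b i)"
  by (simp add: xpow_def power_add prod.distrib)

lemma xpow_single: "xpow (\<lambda>j. if j = i then m else 0) = (var i ^ m :: ('n::finite, 'k::comm_ring_1) mpoly)"
proof -
  have "xpow (\<lambda>j. if j = i then m else 0) = (\<Prod>j\<in>UNIV. if j = i then var j ^ m else (1 :: ('n, 'k) mpoly))"
    unfolding xpow_def by (rule prod.cong) auto
  then show ?thesis by simp
qed

lemma xpow_in_monomial_span [simp]:
  "xpow a \<in> (monomial_span M :: ('n::finite, 'k::comm_ring_1) mpoly set) \<longleftrightarrow> a \<in> M"
  by (simp add: monomial_span_def)

lemma monomial_span_inject [simp]:
  "monomial_span M = (monomial_span N :: ('n::finite, 'k::comm_ring_1) mpoly set) \<longleftrightarrow> M = N"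
  by (metis subsetI subset_antisym xpow_in_monomial_span)

lemma monomial_span_INT: "(\<Inter>j\<in>T. monomial_span (M j)) = monomial_span (\<Inter>j\<in>T. M j)"
  by (auto simp: monomial_span_def)

lemma monomial_span_mono: "M \<subseteq> N \<Longrightarrow> monomial_span M \<subseteq> monomial_span N"
  by (auto simp: monomial_span_def)

lemma restrict_support:
  fixes f :: "('n, 'k::ab_group_add) mpoly"
  obtains g where "support g = support f \<inter> B" "support (f - g) = support f - B"
proof -
  define g where "g = Abs_poly_mapping (\<lambda>k. if Poly_Mapping.lookup k \<in> B then Poly_Mapping.lookup f k else 0)"
  have "finite {k. (if Poly_Mapping.lookup k \<in> B then Poly_Mapping.lookup f k else 0) \<noteq> 0}"
    by (rule finite_subset[OF _ finite_keys[of f]]) (auto simp: in_keys_iff split: if_splits)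
  then have g: "Poly_Mapping.lookup g k = (if Poly_Mapping.lookup k \<in> B then Poly_Mapping.lookup f k else 0)" for k
    by (simp add: g_def Abs_poly_mapping_inverse)
  have "Poly_Mapping.keys g = {k \<in> Poly_Mapping.keys f. Poly_Mapping.lookup k \<in> B}"
    "Poly_Mapping.keys (f - g) = {k \<in> Poly_Mapping.keys f. Poly_Mapping.lookup k \<notin> B}"
    by (auto simp: in_keys_iff g lookup_minus split: if_splits)
  then show ?thesis using that[of g] unfolding support_def by blast
qed

lemma ideal_monomial_span:
  assumes "up_closed M"
  shows "ideal (monomial_span M) (ring_of_type_algebra :: ('n, 'k::comm_ring_1) mpoly ring)"
proof (rule ideal_type_algebraI)
  show "x * f \<in> monomial_span M" if "f \<in> monomial_span M" for x f :: "('n, 'k) mpoly"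
    unfolding monomial_span_def
  proof clarify
    fix c assume "c \<in> support (x * f)"
    then obtain a b where "a \<in> support x" "b \<in> support f" "c = (\<lambda>i. a i + b i)"
      by (rule support_mult)
    then show "c \<in> M" using that up_closedD[OF assms, of b c] by (auto simp: monomial_span_def)
  qed
qed (use support_add in \<open>auto simp: monomial_span_def, blast\<close>)

lemma monomial_span_least:
  fixes J :: "('n::finite, 'k::comm_ring_1) mpoly set"
  assumes J: "ideal J ring_of_type_algebra" and M: "\<And>a. a \<in> M \<Longrightarrow> xpow a \<in> J"
  shows "monomial_span M \<subseteq> J"
proof
  note Jd = ideal_type_algebraD[OF J]
  fix f :: "('n, 'k) mpoly" assume "f \<in> monomial_span M"
  then have f: "support f \<subseteq> M" by (simp add: monomial_span_def)
  have "f = (\<Sum>k\<in>Poly_Mapping.keys f. Poly_Mapping.single k (Poly_Mapping.lookup f k))"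
    by (rule poly_mapping_eqI) (auto simp: lookup_sum lookup_single when_def in_keys_iff)
  moreover have "Poly_Mapping.single k (Poly_Mapping.lookup f k) \<in> J" if "k \<in> Poly_Mapping.keys f" for k
  proof -
    have "xpow (Poly_Mapping.lookup k) \<in> J"
      by (rule M) (use that f in \<open>auto simp: support_def\<close>)
    \<comment> \<open>\<open>Poly_Mapping.single 0 c\<close> is the constant \<open>c\<close>, so
      each term of \<open>f\<close> is a scalar multiple of a monomial in \<open>J\<close>.\<close>
    then have "Poly_Mapping.single 0 (Poly_Mapping.lookup f k) * xpow (Poly_Mapping.lookup k) \<in> J"
      by (rule Jd(3))
    then show ?thesis by (simp add: xpow_eq_single mult_single lookup_inverse)
  qed
  moreover have "(\<Sum>k\<in>T. F k) \<in> J" if "finite T" "\<And>k. k \<in> T \<Longrightarrow> F k \<in> J"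
    for T and F :: "('n \<Rightarrow>\<^sub>0 nat) \<Rightarrow> ('n, 'k) mpoly"
    using that by (induction T) (use Jd in auto)
  ultimately show "f \<in> J" by (metis finite_keys)
qed

lemma ideal_gen_xpow:
  "ideal_gen (xpow ` S) = (monomial_span {a. \<exists>b\<in>S. b \<le> a} :: ('n::finite, 'k::comm_ring_1) mpoly set)"
  (is "_ = monomial_span ?M")
proof
  have up: "up_closed ?M" unfolding up_closed_def by (blast intro: order_trans)
  show "ideal_gen (xpow ` S) \<subseteq> (monomial_span ?M :: ('n, 'k) mpoly set)"
    by (rule ideal_gen_least[OF ideal_monomial_span[OF up]]) auto
  show "monomial_span ?M \<subseteq> (ideal_gen (xpow ` S) :: ('n, 'k) mpoly set)"
  proof (rule monomial_span_least[OF ideal_ideal_gen])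
    fix a assume "a \<in> ?M"
    then obtain b where b: "b \<in> S" "b \<le> a" by blast
    \<comment> \<open>Since \<open>b \<le> a\<close>, the truncated difference is exact.\<close>
    have "xpow (\<lambda>i. a i - b i) * xpow b \<in> (ideal_gen (xpow ` S) :: ('n, 'k) mpoly set)"
      by (rule ideal_type_algebraD(3)[OF ideal_ideal_gen]) (rule subsetD[OF ideal_gen_superset imageI[OF b(1)]])
    moreover have "(\<lambda>i. a i - b i + b i) = a" using b(2) by (auto simp: le_fun_def)
    ultimately show "xpow a \<in> (ideal_gen (xpow ` S) :: ('n, 'k) mpoly set)"
      by (simp add: xpow_mult)
  qed
qed

lemma up_closed_ge: "up_closed {a. \<exists>i\<in>A. w i \<le> a i}"
  unfolding up_closed_def le_fun_def using le_trans by blast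

lemma irreducible_component_eq:
  "irreducible_component A w = (monomial_span {a. \<exists>i\<in>A. w i \<le> a i} :: ('n::finite, 'k::field) mpoly set)"
proof -
  have "(\<lambda>i. var i ^ w i) ` A = (xpow ` (\<lambda>i j. if j = i then w i else 0) ` A :: ('n, 'k) mpoly set)"
    by (simp add: image_image xpow_single)
  moreover have "{a. \<exists>b\<in>(\<lambda>i j. if j = i then w i else 0) ` A. b \<le> a} = {a. \<exists>i\<in>A. w i \<le> a i}"
    by (auto simp: le_fun_def)
  ultimately show ?thesis
    unfolding irreducible_component_def by (simp only: ideal_gen_xpow)
qed

lemma ideal_power_monomial_span:
  assumes M: "up_closed M"
  shows "ideal_power (monomial_span M) s = (monomial_span (power_set M s) :: ('n::finite, 'k::comm_ring_1) mpoly set)"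
proof (induction s)
  case 0
  then show ?case by (simp add: monomial_span_def)
next
  case (Suc s)
  let ?R = "ring_of_type_algebra :: ('n, 'k) mpoly ring"
  note up = up_closed_power_set[of M]
  have "ideal_prod ?R (monomial_span (power_set M s)) (monomial_span M) = monomial_span (power_set M (Suc s))"
  proof
    show "ideal_prod ?R (monomial_span (power_set M s)) (monomial_span M) \<subseteq> monomial_span (power_set M (Suc s))"
    proof
      fix f assume "f \<in> ideal_prod ?R (monomial_span (power_set M s)) (monomial_span M)"
      then show "f \<in> monomial_span (power_set M (Suc s))"
      proof induction
        case (prod g h)
        show ?case unfolding monomial_span_def
        proof clarify
          fix c assume "c \<in> support (g \<otimes>\<^bsub>?R\<^esub> h)"
          then have "c \<in> support (g * h)" by simp
          then obtain a b where "a \<in> support g" "b \<in> support h" "c = (\<lambda>i. a i + b i)" by (rule support_mult)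
          then show "c \<in> power_set M (Suc s)" using prod by (auto simp: monomial_span_def)
        qed
      next
        case (sum g h)
        then show ?case
          using ideal_type_algebraD(2)[OF ideal_monomial_span[OF up[of "Suc s"]]] by (simp del: power_set.simps)
      qed
    qed
    show "monomial_span (power_set M (Suc s)) \<subseteq> ideal_prod ?R (monomial_span (power_set M s)) (monomial_span M)"
    proof (rule monomial_span_least)
      show "ideal (ideal_prod ?R (monomial_span (power_set M s)) (monomial_span M)) ?R"
        by (intro ring.ideal_prod_is_ideal ring_from_type_algebra ideal_monomial_span up M)
      fix a assume "a \<in> power_set M (Suc s)"
      then obtain b c where bc: "b \<in> power_set M s" "c \<in> M" "\<forall>i. b i + c i \<le> a i" by auto
      \<comment> \<open>The slack in \<open>b + c \<le> a\<close> is absorbed into the second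
        factor: \<open>a - b\<close> dominates \<open>c\<close>, so it stays in \<open>M\<close>,
        and the product is exactly \<open>xpow a\<close>.\<close>
      have "(\<lambda>i. a i - b i) \<in> M"
        by (rule up_closedD[OF M bc(2)]) (use bc(3) in \<open>simp add: add.commute add_le_imp_le_diff\<close>)
      then have "xpow b \<otimes>\<^bsub>?R\<^esub> xpow (\<lambda>i. a i - b i) \<in> ideal_prod ?R (monomial_span (power_set M s)) (monomial_span M)"
        using bc(1) by (intro ideal_prod.prod) auto
      moreover have "(\<lambda>i. b i + (a i - b i)) = a" using bc(3) by (auto simp: fun_eq_iff intro: le_add_diff_inverse add_leD1)
      ultimately show "xpow a \<in> ideal_prod ?R (monomial_span (power_set M s)) (monomial_span M)"
        by (simp add: xpow_mult)
    qed
  qed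
  then show ?case by (simp add: Suc.IH)
qed

text \<open>A nonzero product of lowest terms survives: split off from \<open>f\<close> the terms outside \<open>M\<close> that
  have the least degree in the variables of \<open>A\<close>, and from \<open>h\<close> the terms free of these variables.\<close>

lemma monomial_span_primary:
  fixes f h :: "('n::{finite,linorder}, 'k::idom) mpoly"
  assumes M: "up_closed M" and MA: "\<And>a b. a \<in> M \<Longrightarrow> (\<And>i. i \<in> A \<Longrightarrow> a i = b i) \<Longrightarrow> b \<in> M"
    and h: "h \<notin> monomial_span {a. \<exists>i\<in>A. 1 \<le> a i}" and hf: "h * f \<in> monomial_span M"
  shows "f \<in> monomial_span M"
proof (rule ccontr)
  assume "f \<notin> monomial_span M"
  then have ne: "support f - M \<noteq> {}" by (auto simp: monomial_span_def)
  define deg where "deg a = (\<Sum>i\<in>A. a i)" for a :: "'n \<Rightarrow> nat"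
  define d where "d = Min (deg ` (support f - M))"
  have dmin: "d \<le> deg a" if "a \<in> support f - M" for a
    unfolding d_def using that by (intro Min_le) auto
  have "d \<in> deg ` (support f - M)" unfolding d_def using ne by (intro Min_in) auto
  then obtain a0 where a0: "a0 \<in> support f - M" "deg a0 = d" by auto
  obtain f1 where f1: "support f1 = support f \<inter> {a. a \<notin> M \<and> deg a = d}"
    "support (f - f1) = support f - {a. a \<notin> M \<and> deg a = d}" by (rule restrict_support)
  obtain h1 where h1: "support h1 = support h \<inter> {a. deg a = 0}"
    "support (h - h1) = support h - {a. deg a = 0}" by (rule restrict_support)
  have "f1 \<noteq> 0" using a0 f1(1) by (metis (mono_tags, lifting) DiffD1 DiffD2 IntI empty_iff mem_Collect_eq support_0)
  moreover have "h1 \<noteq> 0"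
  proof -
    obtain c where "c \<in> support h" "\<forall>i\<in>A. c i = 0" 
      using h unfolding monomial_span_def by fastforce
    then have "c \<in> support h1" unfolding h1 by (simp add: deg_def)
    then show ?thesis by auto
  qed
  \<comment> \<open>The exponents are linearly ordered through \<open>linorder\<close> on the
    variables, so the polynomial ring has no zero divisors.\<close>
  ultimately have "h1 * f1 \<noteq> 0" by simp
  then obtain c where c: "c \<in> support (h1 * f1)" by (metis ex_in_conv support_eq_empty)
  then obtain a b where ab: "a \<in> support h1" "b \<in> support f1" "c = (\<lambda>i. a i + b i)" by (rule support_mult)
  have aA: "\<forall>i\<in>A. a i = 0" using ab(1) h1 by (auto simp: deg_def)
  have cM: "c \<notin> M" using MA[of c b] aA ab f1(1) by auto
  have cd: "deg c = d" using ab(2) f1(1) aA by (auto simp: deg_def ab(3))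
  \<comment> \<open>None of the three products on the right can contain \<open>c\<close>, which has
    degree \<open>d\<close> in \<open>A\<close> and lies outside \<open>M\<close>: terms of
    \<open>h * f\<close> lie in \<open>M\<close>, terms of \<open>f - f1\<close> lie in
    \<open>M\<close> or have degree above \<open>d\<close>, and terms of \<open>h - h1\<close> add
    positive degree.\<close>
  have "h1 * f1 = h * f - (h * (f - f1) + (h - h1) * f1)" by (simp add: algebra_simps)
  then have "c \<in> support (h * f) \<union> (support (h * (f - f1)) \<union> support ((h - h1) * f1))"
    using c support_minus[of "h * f" "h * (f - f1) + (h - h1) * f1"]
      support_add[of "h * (f - f1)" "(h - h1) * f1"] by auto
  then show False
  proof (elim UnE)
    assume "c \<in> support (h * f)"
    then show False using hf cM by (auto simp: monomial_span_def)
  next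
    assume "c \<in> support (h * (f - f1))"
    then obtain u v where uv: "u \<in> support h" "v \<in> support (f - f1)" "c = (\<lambda>i. u i + v i)" by (rule support_mult)
    have "v \<notin> M" using up_closedD[OF M, of v c] cM uv(3) by auto
    then have "d < deg v" using uv(2) dmin[of v] unfolding f1(2) by force
    moreover have "deg v \<le> deg c" unfolding deg_def uv(3) by (intro sum_mono) auto
    ultimately show False using cd by simp
  next
    assume "c \<in> support ((h - h1) * f1)"
    then obtain u v where uv: "u \<in> support (h - h1)" "v \<in> support f1" "c = (\<lambda>i. u i + v i)" by (rule support_mult)
    then have "deg u \<noteq> 0" "deg v = d" unfolding h1(2) f1(1) by auto
    moreover have "deg c = deg u + deg v" unfolding deg_def uv(3) by (simp add: sum.distrib)
    ultimately show False using cd by simp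
  qed
qed

section \<open>Primes generated by variables\<close>

definition variable_ideal :: "'n set \<Rightarrow> ('n::finite, 'k::field) mpoly set"
  where "variable_ideal A = irreducible_component A (\<lambda>_. 1)"

lemma variable_ideal_eq: "variable_ideal A = monomial_span {a. \<exists>i\<in>A. 1 \<le> a i}"
  unfolding variable_ideal_def by (rule irreducible_component_eq)

text \<open>This is \<open>monomial_span_primary\<close> with all thresholds equal to 1: a factor
  outside the ideal can be cancelled.\<close>

lemma prime_variable_ideal:
  "prime_ideal (variable_ideal A :: ('n::{finite,linorder}, 'k::field) mpoly set)"
proof (rule prime_idealI)
  show "ideal (variable_ideal A :: ('n, 'k) mpoly set) ring_of_type_algebra"
    unfolding variable_ideal_eq by (rule ideal_monomial_span[OF up_closed_ge])
  show "1 \<notin> (variable_ideal A :: ('n, 'k) mpoly set)"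
    unfolding variable_ideal_eq by (simp add: monomial_span_def)
  show "f \<in> variable_ideal A \<or> g \<in> variable_ideal A" if "f * g \<in> variable_ideal A" for f g :: "('n, 'k) mpoly"
    using monomial_span_primary[OF up_closed_ge, of A "\<lambda>_. 1" A f g] that unfolding variable_ideal_eq by auto
qed

lemma variable_ideal_subset_iff:
  "variable_ideal A \<subseteq> (variable_ideal B :: ('n::finite, 'k::field) mpoly set) \<longleftrightarrow> A \<subseteq> B"
proof
  assume sub: "variable_ideal A \<subseteq> (variable_ideal B :: ('n, 'k) mpoly set)"
  show "A \<subseteq> B"
  proof
    fix i assume "i \<in> A"
    then have "xpow (\<lambda>j. if j = i then 1 else 0) \<in> (variable_ideal A :: ('n, 'k) mpoly set)"
      unfolding variable_ideal_eq by auto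
    then have "xpow (\<lambda>j. if j = i then 1 else 0) \<in> (variable_ideal B :: ('n, 'k) mpoly set)" using sub by blast
    then show "i \<in> B" unfolding variable_ideal_eq by (auto split: if_splits)
  qed
next
  assume "A \<subseteq> B"
  then show "variable_ideal A \<subseteq> (variable_ideal B :: ('n, 'k) mpoly set)"
    unfolding variable_ideal_eq by (intro monomial_span_mono) auto
qed

text \<open>Adjoining the variables of \<open>A\<close> one at a time, starting from the zero ideal,
  gives a chain of primes with \<open>card A\<close> steps.\<close>

lemma card_le_height_variable_ideal:
  "enat (card A) \<le> height (variable_ideal A :: ('n::{finite,linorder}, 'k::field) mpoly set)"
proof -
  obtain g where g: "bij_betw g {..<card A} A"
    using ex_bij_betw_nat_finite[of A] by (auto simp: atLeast0LessThan)
  show ?thesis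
  proof (rule chain_length_le_height)
    fix i assume i: "i < card A"
    have "g i \<noteq> g j" if "j < i" for j
      using g i that unfolding bij_betw_def by (metis inj_onD lessThan_iff less_trans nat_neq_iff)
    then have "g i \<notin> g ` {..<i}" by auto
    then show "(variable_ideal (g ` {..<i}) :: ('n, 'k) mpoly set) \<subset> variable_ideal (g ` {..<Suc i})"
      unfolding less_le_not_le variable_ideal_subset_iff by (auto simp: lessThan_Suc)
  qed (use g in \<open>auto simp: prime_variable_ideal bij_betw_def\<close>)
qed

lemma height_variable_ideal_singleton:
  "height (variable_ideal {i} :: ('n::finite, 'k::field) mpoly set) \<le> 1"
proof -
  have "height (ideal_gen {var i :: ('n, 'k) mpoly}) \<le> 1"
  proof (rule height_principal_le_1)
    fix f :: "('n, 'k) mpoly" assume dvd: "\<And>k. var i ^ k dvd f"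
    show "f = 0"
    proof (rule ccontr)
      assume "f \<noteq> 0"
      then obtain c where c: "c \<in> support f" by (metis ex_in_conv support_eq_empty)
      \<comment> \<open>The power is one more than the term \<open>c\<close> of \<open>f\<close> can
        bear.\<close>
      obtain g where "f = var i ^ Suc (c i) * g" using dvd by (blast elim: dvdE)
      then have "c \<in> support (xpow (\<lambda>j. if j = i then Suc (c i) else 0) * g)" using c by (simp add: xpow_single)
      then obtain a b where "a = (\<lambda>j. if j = i then Suc (c i) else 0)" "c = (\<lambda>i. a i + b i)"
        by (elim support_mult) auto
      then have "c i = Suc (c i) + b i" by metis
      then show False by simp
    qed
  qed
  then show ?thesis by (simp add: variable_ideal_def irreducible_component_def)
qed

text \<open>A high power of \<open>f\<close> only has terms of high degree in the variables of \<open>A\<close>.\<close>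

lemma radical_irreducible_component:
  assumes w: "\<And>i. i \<in> A \<Longrightarrow> 1 \<le> w i"
  shows "radical (irreducible_component A w) = (variable_ideal A :: ('n::{finite,linorder}, 'k::field) mpoly set)"
proof (intro equalityI subsetI)
  fix f :: "('n, 'k) mpoly" assume "f \<in> radical (irreducible_component A w)"
  then obtain k where "f ^ k \<in> (irreducible_component A w :: ('n, 'k) mpoly set)" by (auto simp: radical_def)
  moreover have "irreducible_component A w \<subseteq> (variable_ideal A :: ('n, 'k) mpoly set)"
    unfolding irreducible_component_eq variable_ideal_eq by (intro monomial_span_mono) (use w in \<open>auto intro: le_trans\<close>)
  ultimately show "f \<in> variable_ideal A"
    using prime_ideal_power[OF prime_variable_ideal] by blast
next
  fix f :: "('n, 'k) mpoly" assume f: "f \<in> variable_ideal A"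
  have deg: "m \<le> (\<Sum>i\<in>A. a i)" if "a \<in> support (f ^ m)" for m a
    using that
  proof (induction m arbitrary: a)
    case (Suc m)
    then have "a \<in> support (f * f ^ m)" by simp
    then obtain b c where bc: "b \<in> support f" "c \<in> support (f ^ m)" "a = (\<lambda>i. b i + c i)" by (rule support_mult)
    obtain i where "i \<in> A" "1 \<le> b i" using f bc(1) unfolding variable_ideal_eq monomial_span_def by blast
    then have "1 \<le> (\<Sum>i\<in>A. b i)" using member_le_sum[of i A b] by simp
    then show ?case using Suc.IH[OF bc(2)] by (simp add: bc(3) sum.distrib)
  qed simp
  \<comment> \<open>The \<open>Suc\<close> keeps the exponent positive, as \<open>radical\<close>
    demands, and pushes the degree in \<open>A\<close> above the sum of the weights, so that some
    exponent must reach its weight.\<close>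
  define m where "m = Suc (\<Sum>i\<in>A. w i)"
  have "f ^ m \<in> irreducible_component A w"
    unfolding irreducible_component_eq monomial_span_def
  proof clarify
    fix a assume "a \<in> support (f ^ m)"
    then have "(\<Sum>i\<in>A. w i) < (\<Sum>i\<in>A. a i)" using deg[of a m] by (simp add: m_def)
    then show "\<exists>i\<in>A. w i \<le> a i" by (meson sum_mono not_le less_imp_le)
  qed
  then show "f \<in> radical (irreducible_component A w)" unfolding radical_def m_def by auto
qed

section \<open>Edge-weighted graphs\<close>

definition threshold :: "'n set \<Rightarrow> ('n \<Rightarrow> nat) \<Rightarrow> ('n \<Rightarrow> nat) set"
  where "threshold A w = {a. \<exists>i\<in>A. w i \<le> a i}"

lemma up_closed_threshold: "up_closed (threshold A w)"
  unfolding threshold_def by (rule up_closed_ge)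

lemma irreducible_component_threshold: "irreducible_component A w = monomial_span (threshold A w)"
  unfolding threshold_def by (rule irreducible_component_eq)

lemma power_set_2: "a \<in> power_set M 2 \<longleftrightarrow> (\<exists>b\<in>M. \<exists>c\<in>M. \<forall>i. b i + c i \<le> a i)"
proof
  assume "a \<in> power_set M 2"
  then obtain d c where dc: "d \<in> power_set M (Suc 0)" "c \<in> M" "\<forall>i. d i + c i \<le> a i"
    unfolding numeral_2_eq_2 power_set.simps(2)[of M "Suc 0"] by blast
  then obtain b e where "b \<in> M" "\<forall>i. e i + b i \<le> d i" by auto
  moreover have "b i + c i \<le> a i" for i
    using \<open>\<forall>i. e i + b i \<le> d i\<close>[rule_format, of i] dc(3)[rule_format, of i] by simp
  ultimately show "\<exists>b\<in>M. \<exists>c\<in>M. \<forall>i. b i + c i \<le> a i" using dc(2) by blast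
next
  assume "\<exists>b\<in>M. \<exists>c\<in>M. \<forall>i. b i + c i \<le> a i"
  then obtain b c where bc: "b \<in> M" "c \<in> M" "\<forall>i. b i + c i \<le> a i" by blast
  have "b \<in> power_set M (Suc 0)"
    using bc(1) by (auto intro!: bexI[of _ b] exI[of _ "\<lambda>_. 0"])
  then show "a \<in> power_set M 2"
    unfolding numeral_2_eq_2 power_set.simps(2)[of M "Suc 0"] using bc(2,3) by blast
qed

text \<open>Only the variables of \<open>A\<close> matter, since all summands can be set to zero
  outside \<open>A\<close>. This is the hypothesis that \<open>monomial_span_primary\<close> asks of
  the powers of a component.\<close>

lemma power_set_threshold_cong:
  assumes "a \<in> power_set (threshold A w) s" "\<And>i. i \<in> A \<Longrightarrow> a i = a' i"
  shows "a' \<in> power_set (threshold A w) s"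
  using assms
proof (induction s arbitrary: a a')
  case (Suc s)
  then obtain b c where bc: "b \<in> power_set (threshold A w) s" "c \<in> threshold A w" "\<forall>i. b i + c i \<le> a i"
    by auto
  have "(\<lambda>i. if i \<in> A then b i else 0) \<in> power_set (threshold A w) s"
    by (rule Suc.IH[OF bc(1)]) simp
  moreover have "(\<lambda>i. if i \<in> A then c i else 0) \<in> threshold A w"
    using bc(2) by (auto simp: threshold_def)
  moreover have "\<forall>i. (if i \<in> A then b i else 0) + (if i \<in> A then c i else 0) \<le> a' i"
    using bc(3) Suc.prems(2) by (simp flip: Suc.prems(2))
  ultimately show ?case unfolding power_set.simps mem_Collect_eq by (intro bexI)
qed simp

text \<open>The quotients count how many copies of each of the two generators fit into
  \<open>a\<close>, and membership in the power asks for \<open>s\<close> copies in total.\<close>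

lemma power_set_edge:
  assumes xy: "x \<noteq> y" and w: "1 \<le> w x" "1 \<le> w y"
  shows "a \<in> power_set (threshold {x, y} w) s \<longleftrightarrow> s \<le> a x div w x + a y div w y"
proof (induction s arbitrary: a)
  case (Suc s)
  show ?case
  proof
    assume "a \<in> power_set (threshold {x, y} w) (Suc s)"
    then obtain b c where bc: "b \<in> power_set (threshold {x, y} w) s" "c \<in> threshold {x, y} w"
      "\<forall>i. b i + c i \<le> a i" by auto
    have s: "s \<le> b x div w x + b y div w y" using Suc.IH bc(1) by blast
    have le: "b i div w i \<le> a i div w i" for i using bc(3) by (meson add_leD1 div_le_mono)
    have lt: "b i div w i + 1 \<le> a i div w i" if "w i \<le> c i" "1 \<le> w i" for i
    proof -
      have "b i div w i + 1 = (b i + w i) div w i" using that by simp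
      also have "\<dots> \<le> a i div w i"
        using that(1) bc(3)[rule_format, of i] by (intro div_le_mono) simp
      finally show ?thesis .
    qed
    show "Suc s \<le> a x div w x + a y div w y"
      using bc(2) s le[of x] le[of y] lt[of x] lt[of y] w by (auto simp: threshold_def)
  next
    assume s: "Suc s \<le> a x div w x + a y div w y"
    \<comment> \<open>Here \<open>u\<close> is an endpoint with positive quotient; taking
      \<open>w u\<close> away from \<open>a u\<close> lowers that quotient by exactly one and leaves
      the other alone.\<close>
    have step: "a \<in> power_set (threshold {x, y} w) (Suc s)"
      if uv: "{u, v} = {x, y}" "u \<noteq> v" and pos: "1 \<le> a u div w u" "1 \<le> w u" for u v
    proof -
      have au: "w u \<le> a u" using pos by (metis div_less not_le not_one_le_zero)
      have "(a(u := a u - w u)) \<in> power_set (threshold {x, y} w) s"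
      proof (rule Suc.IH[THEN iffD2])
        have "a u div w u = (a u - w u) div w u + 1"
          using le_div_geq[of "w u" "a u"] au pos(2) by simp
        then show "s \<le> (a(u := a u - w u)) x div w x + (a(u := a u - w u)) y div w y"
          using s uv xy by (auto simp: doubleton_eq_iff)
      qed
      moreover have "(\<lambda>i. if i = u then w u else 0) \<in> threshold {x, y} w"
        unfolding threshold_def using uv by auto
      moreover have "\<forall>i. (a(u := a u - w u)) i + (if i = u then w u else 0) \<le> a i" using au by simp
      ultimately show ?thesis unfolding power_set.simps mem_Collect_eq by (intro bexI)
    qed
    show "a \<in> power_set (threshold {x, y} w) (Suc s)"
    proof (cases "1 \<le> a x div w x")
      case True
      then show ?thesis using step[of x y] xy w by blast
    next
      case False
      then show ?thesis using step[of y x] xy w s by (auto simp: insert_commute)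
    qed
  qed
qed simp

text \<open>What remains of the decomposition once every \<open>A j\<close> is known to be an edge.
  Injectivity of \<open>A\<close> excludes parallel edges; it will come from the distinctness of the
  radicals.\<close>

locale edge_weighting =
  fixes T :: "'i set" and A :: "'i \<Rightarrow> 'n::finite set" and w :: "'i \<Rightarrow> 'n \<Rightarrow> nat"
  assumes fin: "finite T" and card2: "j \<in> T \<Longrightarrow> card (A j) = 2"
    and injA: "inj_on A T" and wpos: "j \<in> T \<Longrightarrow> i \<in> A j \<Longrightarrow> 1 \<le> w j i"
begin

definition covers :: "('n \<Rightarrow> nat) set"
  where "covers = (\<Inter>j\<in>T. threshold (A j) (w j))"

text \<open>The exponents of the intersection of the \<open>s\<close>-th powers of the components,
  which will turn out to be the \<open>s\<close>-th symbolic power.\<close>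

definition edgewise_power :: "nat \<Rightarrow> ('n \<Rightarrow> nat) set"
  where "edgewise_power s = (\<Inter>j\<in>T. power_set (threshold (A j) (w j)) s)"

lemma edge_unique: "j \<in> T \<Longrightarrow> k \<in> T \<Longrightarrow> A j = A k \<Longrightarrow> j = k"
  using injA by (rule inj_onD)

lemma weight_bound: obtains m where "\<And>j i. j \<in> T \<Longrightarrow> w j i \<le> m"
proof
  fix j i assume "j \<in> T"
  then show "w j i \<le> Max ((\<lambda>(j, i). w j i) ` (T \<times> UNIV))"
    using fin by (intro Max_ge) (auto simp: image_iff)
qed

text \<open>Distinct edges have equal size, so neither contains the other. Hence large exponents
  outside \<open>A j\<close> satisfy all edges but \<open>j\<close>.\<close>

lemma other_vertex:
  assumes "j \<in> T" "k \<in> T" "j \<noteq> k"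
  shows "\<not> A k \<subseteq> A j"
proof
  assume "A k \<subseteq> A j"
  then have "A k = A j" using card2 assms by (metis card_subset_eq finite)
  then show False using edge_unique assms by blast
qed

lemma covers_edge:
  assumes "b \<in> covers" "j \<in> T" "A j = {x, y}"
  shows "w j x \<le> b x \<or> w j y \<le> b y"
proof -
  have "b \<in> threshold (A j) (w j)" using assms(1,2) unfolding covers_def by blast
  then show ?thesis unfolding assms(3) threshold_def by simp
qed

section \<open>Vertex weights and a bipartition from the second power\<close>

lemma covers_power_subset: "power_set covers s \<subseteq> edgewise_power s"
  unfolding edgewise_power_def by (intro INT_greatest power_set_mono) (auto simp: covers_def)

text \<open>Writing \<open>p\<close>, \<open>P\<close> for the weights of \<open>xy\<close>, \<open>xz\<close> at \<open>x\<close> and \<open>Q\<close> for the weight of \<open>xz\<close> at \<open>z\<close>, the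
  monomial \<open>x\<^bsup>max P (2p)\<^esup> y\<^sup>t z\<^sup>Q\<close> has an almost forced factorization: one factor lacks \<open>z\<^sup>Q\<close> and so
  takes \<open>x\<^sup>P\<close>, which leaves less than \<open>x\<^sup>p\<close> for the other factor.\<close>

lemma split_third_edge:
  assumes eq: "edgewise_power 2 \<subseteq> power_set covers 2"
    and j: "j \<in> T" "A j = {x, y}" and k: "k \<in> T" "A k = {x, z}" and xyz: "x \<noteq> y" "x \<noteq> z" "y \<noteq> z"
    and less: "w j x < w k x"
    and t: "\<And>l. l \<in> T \<Longrightarrow> A l = {y, z} \<Longrightarrow> 2 \<le> t div w l y + w k z div w l z"
  shows "w j y \<le> t" "\<And>l. l \<in> T \<Longrightarrow> A l = {y, z} \<Longrightarrow> w j y + w l y \<le> t"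
proof -
  obtain m where m: "\<And>j i. j \<in> T \<Longrightarrow> w j i \<le> m" using weight_bound by blast
  define e where "e = max (w k x) (2 * w j x)"
  \<comment> \<open>Away from \<open>x\<close>, \<open>y\<close>, \<open>z\<close> the exponent
    \<open>2 * m\<close> holds two full weights, so an edge leaving the triangle is settled by its
    outer endpoint alone.\<close>
  define a where "a = (\<lambda>_. 2 * m)(x := e, y := t, z := w k z)"
  have ax: "a x = e" "a y = t" "a z = w k z" using xyz by (auto simp: a_def)
  have pj: "1 \<le> w j x" "1 \<le> w j y" and pk: "1 \<le> w k x" "1 \<le> w k z" using wpos j k by auto
  have "a \<in> edgewise_power 2"
    unfolding edgewise_power_def
  proof
    fix l assume l: "l \<in> T"
    obtain u v where uv: "A l = {u, v}" "u \<noteq> v" using card2[OF l] by (auto simp: card_2_iff)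
    have pl: "1 \<le> w l u" "1 \<le> w l v" using wpos[OF l] uv by auto
    have mem: "a \<in> power_set (threshold (A l) (w l)) 2 \<longleftrightarrow> 2 \<le> a u div w l u + a v div w l v"
      unfolding uv(1) by (rule power_set_edge[where w = "w l", OF uv(2) pl])
    have big: "2 \<le> a o' div w l o'" if "o' \<in> A l" "o' \<notin> {x, y, z}" for o'
    proof -
      have "a o' = 2 * m" using that by (simp add: a_def)
      moreover have "2 * w l o' \<le> 2 * m" using m[OF l, of o'] by simp
      moreover have "0 < w l o'" using wpos[OF l that(1)] by simp
      ultimately show ?thesis by (simp add: less_eq_div_iff_mult_less_eq)
    qed
    show "a \<in> power_set (threshold (A l) (w l)) 2"
    proof (cases "u \<in> {x, y, z} \<and> v \<in> {x, y, z}")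
      case False
      then show ?thesis unfolding mem using big[of u] big[of v] uv by auto
    next
      case True
      then consider "{u, v} = {x, y}" | "{u, v} = {x, z}" | "{u, v} = {y, z}" using uv(2) by auto
      then show ?thesis
      proof cases
        case 1
        then have "l = j" using uv j l edge_unique by simp
        have "2 * w j x \<le> e" by (simp add: e_def)
        then have "2 \<le> a x div w j x" using pj by (simp add: ax less_eq_div_iff_mult_less_eq)
        then show ?thesis using 1 unfolding mem unfolding \<open>l = j\<close> by (auto simp: doubleton_eq_iff)
      next
        case 2
        then have "l = k" using uv k l edge_unique by simp
        have "w k x \<le> e" by (simp add: e_def)
        then have "1 \<le> a x div w k x" using pk by (simp add: ax less_eq_div_iff_mult_less_eq)
        moreover have "a z div w k z = 1" using pk by (simp add: ax)
        ultimately show ?thesis using 2 unfolding mem unfolding \<open>l = k\<close> by (auto simp: doubleton_eq_iff)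
      next
        case 3
        then have "2 \<le> a y div w l y + a z div w l z" using t[OF l] uv ax by simp
        then show ?thesis using 3 unfolding mem by (auto simp: doubleton_eq_iff)
      qed
    qed
  qed
  then obtain b c where "b \<in> covers" "c \<in> covers" "\<forall>i. b i + c i \<le> a i"
    using eq power_set_2[of a covers] by blast
  \<comment> \<open>The factors share at most \<open>w k z\<close> at \<open>z\<close>, so one of
    them falls short of it; by symmetry it is named \<open>b\<close>.\<close>
  then obtain b c where bc: "b \<in> covers" "c \<in> covers" "\<forall>i. b i + c i \<le> a i" and bz: "b z < w k z"
  proof (cases "b z < w k z")
    case False
    then have "c z < w k z" using \<open>\<forall>i. b i + c i \<le> a i\<close>[rule_format, of z] pk ax by simp
    then show ?thesis using that[of c b] \<open>b \<in> covers\<close> \<open>c \<in> covers\<close> \<open>\<forall>i. b i + c i \<le> a i\<close>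
      by (simp add: add.commute)
  qed auto
  have le: "b x + c x \<le> e" "b y + c y \<le> t" "b z + c z \<le> w k z" using bc(3) ax by metis+
  have "w k x \<le> b x" using covers_edge[OF bc(1) k] bz by simp
  \<comment> \<open>If \<open>e = w k x\<close>, nothing is left for \<open>c x\<close>; if
    \<open>e = 2 * w j x\<close>, at most \<open>2 * w j x - w k x\<close> is left.\<close>
  then have cx: "c x < w j x" using le(1) less pj by (simp add: e_def max_def split: if_splits)
  then have cy: "w j y \<le> c y" using covers_edge[OF bc(2) j] by simp
  \<comment> \<open>\<open>c\<close> falls short of \<open>w k x\<close> as well, so it takes all of
    \<open>z\<close>. With \<open>b z = 0\<close>, the factor \<open>b\<close> can meet an edge
    \<open>yz\<close> only at \<open>y\<close>.\<close>
  have "w k z \<le> c z" using covers_edge[OF bc(2) k] cx less by simp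
  then have "b z = 0" using le(3) by simp
  show "w j y \<le> t" using cy le(2) by simp
  show "w j y + w l y \<le> t" if "l \<in> T" "A l = {y, z}" for l
  proof -
    have "w l y \<le> b y" using covers_edge[OF bc(1) that] that \<open>b z = 0\<close> wpos[of l z] by auto
    then show ?thesis using cy le(2) by simp
  qed
qed

text \<open>Three choices of the exponent \<open>t\<close> in \<open>split_third_edge\<close>:
  \<open>0\<close> if there were no edge \<open>yz\<close>, \<open>w l y\<close> if
  \<open>w l z \<le> w k z\<close>, and \<open>2 * w l y\<close> for the last inequality.\<close>

lemma third_edge:
  assumes eq: "edgewise_power 2 \<subseteq> power_set covers 2"
    and j: "j \<in> T" "A j = {x, y}" and k: "k \<in> T" "A k = {x, z}" and xyz: "x \<noteq> y" "x \<noteq> z" "y \<noteq> z"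
    and less: "w j x < w k x"
  obtains l where "l \<in> T" "A l = {y, z}" "w k z < w l z" "w j y \<le> w l y"
proof -
  note split = split_third_edge[OF eq j k xyz less]
  have pj: "1 \<le> w j y" using wpos j by auto
  obtain l where l: "l \<in> T" "A l = {y, z}"
  proof (rule ccontr)
    assume "\<not> thesis"
    then have "w j y \<le> 0" by (intro split(1)[of 0]) (use that in auto)
    then show False using pj by simp
  qed
  have uniq: "l' = l" if "l' \<in> T" "A l' = {y, z}" for l' using l that edge_unique by simp
  have pl: "1 \<le> w l y" "1 \<le> w l z" using wpos l by auto
  have v: "w k z < w l z"
  proof (rule ccontr)
    assume "\<not> w k z < w l z"
    then have "1 \<le> w k z div w l z" using pl by (simp add: less_eq_div_iff_mult_less_eq)
    then have "w j y + w l y \<le> w l y"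
      by (intro split(2)[OF _ l]) (use uniq pl in auto)
    then show False using pj by simp
  qed
  have "w j y + w l y \<le> 2 * w l y"
    by (intro split(2)[OF _ l]) (use uniq pl in auto)
  then show thesis using that[OF l v] by simp
qed

text \<open>If the weights of the edges \<open>xy\<close>, \<open>xz\<close> differed at \<open>x\<close>, then they would lie in a triangle,
  and the inequalities obtained at \<open>x\<close> and then at \<open>z\<close> contradict each other at \<open>y\<close>.\<close>

lemma weights_agree:
  assumes eq: "edgewise_power 2 \<subseteq> power_set covers 2"
    and "j \<in> T" "k \<in> T" "x \<in> A j" "x \<in> A k"
  shows "w j x = w k x"
proof -
  have "\<not> w j x < w k x" if jk: "j \<in> T" "k \<in> T" "x \<in> A j" "x \<in> A k" for j k
  proof
    assume less: "w j x < w k x"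
    obtain y where y: "A j = {x, y}" "x \<noteq> y"
      using card2[OF jk(1)] jk(3) by (auto simp: card_2_iff doubleton_eq_iff)
    obtain z where z: "A k = {x, z}" "x \<noteq> z"
      using card2[OF jk(2)] jk(4) by (auto simp: card_2_iff doubleton_eq_iff)
    have yz: "y \<noteq> z"
    proof
      assume "y = z"
      then have "j = k" using edge_unique jk(1,2) y z by simp
      then show False using less by simp
    qed
    obtain l where l: "l \<in> T" "A l = {y, z}" "w k z < w l z" "w j y \<le> w l y"
      using third_edge[OF eq jk(1) y(1) jk(2) z(1) y(2) z(2) yz less] by blast
    \<comment> \<open>The inequality at \<open>z\<close> makes \<open>third_edge\<close> applicable
      there to \<open>xz\<close> and \<open>yz\<close>; the edge it yields can only be
      \<open>j\<close>.\<close>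
    obtain l' where l': "l' \<in> T" "A l' = {x, y}" "w l y < w l' y"
    proof (rule third_edge[OF eq jk(2) _ l(1) _ _ _ _ l(3)])
      show "A k = {z, x}" "A l = {z, y}" using z(1) l(2) by (simp_all add: insert_commute)
    qed (use y(2) z(2) yz in auto)
    then have "l' = j" using edge_unique jk(1) y by simp
    then show False using l'(3) l(4) by simp
  qed
  then show ?thesis using assms by (meson linorder_neqE_nat)
qed

lemma vertex_weighting:
  assumes eq: "edgewise_power 2 \<subseteq> power_set covers 2"
  obtains W where "\<And>i. 0 < W i" "\<And>j i. j \<in> T \<Longrightarrow> i \<in> A j \<Longrightarrow> w j i = W i"
proof
  \<comment> \<open>By \<open>weights_agree\<close> any edge at \<open>i\<close> may be chosen. The
    value 1 at isolated vertices keeps \<open>W\<close> positive.\<close>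
  define W where "W i = (if \<exists>j\<in>T. i \<in> A j then w (SOME j. j \<in> T \<and> i \<in> A j) i else 1)" for i
  have some: "(SOME j. j \<in> T \<and> i \<in> A j) \<in> T" "i \<in> A (SOME j. j \<in> T \<and> i \<in> A j)"
    if "\<exists>j\<in>T. i \<in> A j" for i
    using someI_ex[of "\<lambda>j. j \<in> T \<and> i \<in> A j"] that by blast+
  show "0 < W i" for i using wpos[OF some, of i] by (force simp: W_def)
  show "w j i = W i" if "j \<in> T" "i \<in> A j" for j i
    using weights_agree[OF eq that(1) some(1) that(2) some(2)] that unfolding W_def by auto
qed

lemma bipartite_of_power_2:
  assumes eq: "edgewise_power 2 \<subseteq> power_set covers 2"
  shows "bipartite UNIV (A ` T)"
proof -
  obtain W where W: "\<And>i. 0 < W i" "\<And>j i. j \<in> T \<Longrightarrow> i \<in> A j \<Longrightarrow> w j i = W i"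
    using vertex_weighting[OF eq] by blast
  have "W \<in> edgewise_power 2"
    unfolding edgewise_power_def
  proof
    fix j assume j: "j \<in> T"
    obtain x y where xy: "A j = {x, y}" "x \<noteq> y" using card2[OF j] by (auto simp: card_2_iff)
    then have "w j x = W x" "w j y = W y" using W(2)[OF j] by auto
    then show "W \<in> power_set (threshold (A j) (w j)) 2"
      unfolding xy(1) using W(1)[of x] W(1)[of y] by (subst power_set_edge) (use xy in auto)
  qed
  then obtain b c where bc: "b \<in> covers" "c \<in> covers" "\<forall>i. b i + c i \<le> W i"
    using eq power_set_2[of W covers] by blast
  \<comment> \<open>Both factors must meet every edge, and they never do so at the same vertex;
    hence each edge has one end where \<open>b\<close> reaches \<open>W\<close> and one where it
    does not.\<close>
  have disj: "\<not> (W i \<le> b i \<and> W i \<le> c i)" for i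
    using bc(3)[rule_format, of i] W(1)[of i] by auto
  show ?thesis
    unfolding bipartite_def
  proof (intro exI conjI ballI)
    fix e assume "e \<in> A ` T"
    then obtain j where j: "j \<in> T" "e = A j" by blast
    obtain x y where xy: "A j = {x, y}" "x \<noteq> y" using card2[OF j(1)] by (auto simp: card_2_iff)
    have "W x \<le> b x \<or> W y \<le> b y" "W x \<le> c x \<or> W y \<le> c y"
      using covers_edge[OF bc(1) j(1) xy(1)] covers_edge[OF bc(2) j(1) xy(1)] W(2)[OF j(1)] xy(1)
      by simp_all
    then show "\<exists>u\<in>{i. W i \<le> b i}. \<exists>v\<in>{i. \<not> W i \<le> b i}. e = {u, v}"
      using disj[of x] disj[of y] xy j(2) by (auto simp: insert_commute)
  qed auto
qed

text \<open>With \<open>d i = \<lfloor>a i / W i\<rfloor>\<close>, the sets \<open>{i \<in> U. t < d i} \<union> {i \<in> V. s \<le> t + d i}\<close> for \<open>t < s\<close>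
  are \<open>s\<close> vertex covers whose total weight is at most \<open>a\<close>.\<close>

lemma edgewise_power_subset:
  assumes W: "\<And>j i. j \<in> T \<Longrightarrow> i \<in> A j \<Longrightarrow> w j i = W i"
    and bip: "bipartite UNIV (A ` T)"
  shows "edgewise_power s \<subseteq> power_set covers s"
proof
  obtain U V where UV: "U \<inter> V = {}" and e: "\<forall>e\<in>A ` T. \<exists>u\<in>U. \<exists>v\<in>V. e = {u, v}"
    using bip unfolding bipartite_def by (elim exE conjE)
  fix a assume a: "a \<in> edgewise_power s"
  define d where "d i = a i div W i" for i
  define b where "b t i = (if (if i \<in> U then t < d i else s \<le> t + d i) then W i else 0)" for t i
  show "a \<in> power_set covers s"
  proof (rule sum_in_power_set)
    fix t assume "t < s"
    show "b t \<in> covers"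
      unfolding covers_def
    proof
      fix j assume j: "j \<in> T"
      obtain u v where uv: "u \<in> U" "v \<in> V" "A j = {u, v}" using e j by blast
      have neq: "u \<noteq> v" "v \<notin> U" using uv UV by auto
      have "a \<in> power_set (threshold {u, v} (w j)) s" using a j uv(3) by (auto simp: edgewise_power_def)
      then have "s \<le> a u div w j u + a v div w j v"
        using power_set_edge[OF neq(1), of "w j" a s] wpos[OF j] uv(3) by auto
      then have "s \<le> d u + d v" using W[OF j] uv(3) by (simp add: d_def)
      \<comment> \<open>If \<open>t < d u\<close> fails, then \<open>d u \<le> t\<close>, and
        \<open>s \<le> d u + d v\<close> gives \<open>s \<le> t + d v\<close>.\<close>
      then have "W u \<le> b t u \<or> W v \<le> b t v" using uv neq by (auto simp: b_def)
      then show "b t \<in> threshold (A j) (w j)" using W[OF j] uv(3) by (auto simp: threshold_def)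
    qed
  next
    fix i
    \<comment> \<open>A vertex \<open>i\<close> is used for the first \<open>d i\<close> values of
      \<open>t\<close> if it lies in \<open>U\<close>, and for the last \<open>d i\<close> values
      otherwise.\<close>
    have "card {t. t < s \<and> t < d i} \<le> card {..<d i}" by (intro card_mono) auto
    moreover have "card {t. t < s \<and> s \<le> t + d i} \<le> card {s - d i..<s}" by (intro card_mono) auto
    ultimately have *: "card {t. t < s \<and> (if i \<in> U then t < d i else s \<le> t + d i)} \<le> d i"
      by (cases "i \<in> U") auto
    have "(\<Sum>t<s. b t i) = card {t. t < s \<and> (if i \<in> U then t < d i else s \<le> t + d i)} * W i"
      unfolding b_def by (subst sum.inter_filter[symmetric]) auto
    also have "\<dots> \<le> d i * W i" by (rule mult_le_mono1[OF *])
    also have "\<dots> \<le> a i" by (simp add: d_def)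
    finally show "(\<Sum>t<s. b t i) \<le> a i" .
  qed
qed

text \<open>By hypothesis, membership in \<open>covers\<close> depends only on which exponents reach
  \<open>W\<close>. This is tested on the vector with \<open>t\<close> at \<open>x\<close>, 0 at
  \<open>y\<close> and a large value elsewhere: all edges but \<open>j\<close> are satisfied, so it
  lies in \<open>covers\<close> just when \<open>w j x \<le> t\<close>.\<close>

lemma weighted_covers_threshold:
  assumes W: "\<And>a b. a \<in> covers \<Longrightarrow> (\<And>i. W i \<le> a i \<Longrightarrow> W i \<le> b i) \<Longrightarrow> b \<in> covers"
    and j: "j \<in> T" "x \<in> A j"
  shows "w j x = W x"
proof -
  obtain y where y: "A j = {x, y}" "x \<noteq> y"
    using card2[OF j(1)] j(2) by (auto simp: card_2_iff doubleton_eq_iff)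
  obtain m where m: "\<And>j i. j \<in> T \<Longrightarrow> w j i \<le> m" using weight_bound by blast
  define a where "a t = (\<lambda>_. m)(x := t, y := 0)" for t
  have a: "a t \<in> covers \<longleftrightarrow> w j x \<le> t" for t
  proof
    assume "a t \<in> covers"
    then have "w j x \<le> a t x \<or> w j y \<le> a t y" using covers_edge j(1) y(1) by blast
    then show "w j x \<le> t" using wpos[OF j(1), of y] y by (simp add: a_def)
  next
    assume t: "w j x \<le> t"
    show "a t \<in> covers"
      unfolding covers_def
    proof
      fix k assume k: "k \<in> T"
      show "a t \<in> threshold (A k) (w k)"
      proof (cases "k = j")
        case True
        then show ?thesis using t y by (auto simp: threshold_def a_def)
      next
        case False
        then obtain i where "i \<in> A k" "i \<notin> {x, y}" using other_vertex[OF j(1) k] y by auto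
        then show ?thesis using m[OF k, of i] by (auto simp: threshold_def a_def)
      qed
    qed
  qed
  have step: "w j x \<le> t" if "W x \<le> w j x \<Longrightarrow> W x \<le> t" for t
  proof -
    have "a t \<in> covers"
      by (rule W[of "a (w j x)"]) (use that a y in \<open>auto simp: a_def split: if_splits\<close>)
    then show ?thesis by (simp add: a)
  qed
  \<comment> \<open>The choice \<open>t = 0\<close> rules out \<open>w j x < W x\<close>, and
    \<open>t = W x\<close> gives \<open>w j x \<le> W x\<close>.\<close>
  have "1 \<le> w j x" by (rule wpos[OF j])
  then show ?thesis using step[of 0] step[of "W x"] by (metis le_antisym le_refl not_one_le_zero le_zero_eq)
qed

text \<open>Squarefree generators only ask which exponents reach \<open>W\<close>, so
  \<open>weighted_covers_threshold\<close> applies. Conversely, vertex weights turn the cover ideal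
  of the graph into the given ideal.\<close>

lemma has_standard_linear_weighting_iff:
  "has_standard_linear_weighting (monomial_span covers :: ('n, 'k::field) mpoly set) \<longleftrightarrow>
    (\<exists>W. (\<forall>i. 0 < W i) \<and> (\<forall>j\<in>T. \<forall>i\<in>A j. w j i = W i))"
proof
  have weighted: "(weighted_ideal W (ideal_gen (xpow ` S)) :: ('n, 'k) mpoly set) =
      monomial_span {a. \<exists>b. (\<exists>c\<in>S. c \<le> b) \<and> (\<lambda>i. W i * b i) \<le> a}" for W S
  proof -
    have "{xpow (\<lambda>i. W i * b i) | b. xpow b \<in> (ideal_gen (xpow ` S) :: ('n, 'k) mpoly set)}
      = (xpow ` {\<lambda>i. W i * b i | b. \<exists>c\<in>S. c \<le> b} :: ('n, 'k) mpoly set)"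
      unfolding ideal_gen_xpow by auto
    then show ?thesis unfolding weighted_ideal_def ideal_gen_xpow[of S]
      by (simp add: ideal_gen_xpow) (metis (no_types, lifting))
  qed
  {
    assume "has_standard_linear_weighting (monomial_span covers :: ('n, 'k) mpoly set)"
    then obtain S W where S: "\<forall>a\<in>S. \<forall>i. a i \<le> 1" and W: "\<forall>i. 0 < W i"
      and eq: "(monomial_span covers :: ('n, 'k) mpoly set) = weighted_ideal W (ideal_gen (xpow ` S))"
      unfolding has_standard_linear_weighting_def squarefree_monomial_ideal_def by blast
    have cov: "covers = {a. \<exists>b. (\<exists>c\<in>S. c \<le> b) \<and> (\<lambda>i. W i * b i) \<le> a}"
      using eq unfolding weighted by simp
    have "b \<in> covers" if a: "a \<in> covers" and imp: "\<And>i. W i \<le> a i \<Longrightarrow> W i \<le> b i" for a b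
    proof -
      obtain d c where dc: "c \<in> S" "c \<le> d" "(\<lambda>i. W i * d i) \<le> a" using a unfolding cov by blast
      have "W i * c i \<le> b i" for i
      proof (cases "c i = 0")
        case False
        then have "c i = 1" using S dc(1) by (metis le_antisym less_one not_le)
        then have "W i \<le> W i * d i" using dc(2)[THEN le_funD, of i] by simp
        also have "\<dots> \<le> a i" using dc(3)[THEN le_funD, of i] .
        finally show ?thesis using imp \<open>c i = 1\<close> by simp
      qed simp
      then show ?thesis unfolding cov using dc(1) by (auto simp: le_fun_def)
    qed
    then have "\<forall>j\<in>T. \<forall>i\<in>A j. w j i = W i" using weighted_covers_threshold[of W] by blast
    then show "\<exists>W. (\<forall>i. 0 < W i) \<and> (\<forall>j\<in>T. \<forall>i\<in>A j. w j i = W i)" using W by blast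
  next
    assume "\<exists>W. (\<forall>i. 0 < W i) \<and> (\<forall>j\<in>T. \<forall>i\<in>A j. w j i = W i)"
    then obtain W where W: "\<forall>i. 0 < W i" "\<And>j i. j \<in> T \<Longrightarrow> i \<in> A j \<Longrightarrow> w j i = W i" by blast
    \<comment> \<open>The indicator vectors of the vertex covers.\<close>
    define S where "S = {c :: 'n \<Rightarrow> nat. (\<forall>i. c i \<le> 1) \<and> (\<forall>j\<in>T. \<exists>i\<in>A j. c i = 1)}"
    have "covers = {a. \<exists>b. (\<exists>c\<in>S. c \<le> b) \<and> (\<lambda>i. W i * b i) \<le> a}"
    proof (intro equalityI subsetI)
      fix a assume a: "a \<in> covers"
      define c where "c i = (if W i \<le> a i then 1 else 0 :: nat)" for i
      have "c \<in> S" 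
        unfolding S_def
      proof safe
        fix j assume j: "j \<in> T"
        then have "a \<in> threshold (A j) (w j)" using a unfolding covers_def by (rule INT_D[rotated])
        then show "\<exists>i\<in>A j. c i = 1" using W(2)[OF j] unfolding threshold_def c_def by auto
      qed (simp add: c_def)
      moreover have "(\<lambda>i. W i * c i) \<le> a" by (auto simp: c_def le_fun_def)
      ultimately show "a \<in> {a. \<exists>b. (\<exists>c\<in>S. c \<le> b) \<and> (\<lambda>i. W i * b i) \<le> a}" by blast
    next
      fix a assume "a \<in> {a. \<exists>b. (\<exists>c\<in>S. c \<le> b) \<and> (\<lambda>i. W i * b i) \<le> a}"
      then obtain b c where bc: "c \<in> S" "c \<le> b" "(\<lambda>i. W i * b i) \<le> a" by blast
      show "a \<in> covers"
        unfolding covers_def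
      proof
        fix j assume j: "j \<in> T"
        then obtain i where i: "i \<in> A j" "c i = 1" using bc(1) by (auto simp: S_def)
        then have "w j i \<le> W i * b i" using W(2)[OF j] bc(2)[THEN le_funD, of i] by simp
        also have "\<dots> \<le> a i" using bc(3)[THEN le_funD, of i] .
        finally show "a \<in> threshold (A j) (w j)" using i by (auto simp: threshold_def)
      qed
    qed
    then have "(monomial_span covers :: ('n, 'k) mpoly set) = weighted_ideal W (ideal_gen (xpow ` S))"
      unfolding weighted by (rule arg_cong)
    moreover have "squarefree_monomial_ideal (ideal_gen (xpow ` S) :: ('n, 'k) mpoly set)"
      unfolding squarefree_monomial_ideal_def by (rule exI[of _ S]) (simp add: S_def)
    ultimately show "has_standard_linear_weighting (monomial_span covers :: ('n, 'k) mpoly set)"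
      unfolding has_standard_linear_weighting_def using W(1) by blast
  }
qed

end

section \<open>Associated primes and symbolic powers\<close>

text \<open>Irredundancy supplies a monomial in every component but the \<open>k\<close>-th. Once
  its exponents on \<open>A k\<close> are as large as that allows, its annihilator modulo
  \<open>I\<close> is the prime of \<open>A k\<close>.\<close>

lemma variable_ideal_associated:
  fixes A :: "'i \<Rightarrow> 'n::{finite,linorder} set"
  assumes I: "I = (\<Inter>j\<in>T. irreducible_component (A j) (w j))"
    and irr: "I \<noteq> (\<Inter>j\<in>T - {k}. irreducible_component (A j) (w j))"
    and k: "k \<in> T" and w: "\<And>i. i \<in> A k \<Longrightarrow> 1 \<le> w k i"
  shows "variable_ideal (A k) \<in> associated_primes (I :: ('n, 'k::field) mpoly set)"
proof -
  define Q where "Q j = threshold (A j) (w j)" for j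
  have I': "I = monomial_span (\<Inter>j\<in>T. Q j)"
    unfolding I irreducible_component_threshold Q_def by (rule monomial_span_INT)
  have "(\<Inter>j\<in>T. Q j) \<noteq> (\<Inter>j\<in>T - {k}. Q j)"
    using irr unfolding I' irreducible_component_threshold monomial_span_INT Q_def[symmetric] by simp
  then obtain a where a: "a \<in> (\<Inter>j\<in>T - {k}. Q j)" "a \<notin> Q k" by blast
  \<comment> \<open>One below the threshold on \<open>A k\<close>: \<open>b\<close> still misses the
    component \<open>k\<close>, but any further variable of \<open>A k\<close> moves it
    inside.\<close>
  define b where "b i = (if i \<in> A k then w k i - 1 else a i)" for i
  have "a \<le> b" using a(2) by (auto simp: le_fun_def b_def Q_def threshold_def)
  then have b: "b \<in> (\<Inter>j\<in>T - {k}. Q j)"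
    using a(1) up_closed_threshold unfolding Q_def up_closed_def by blast
  have bk: "b \<notin> Q k" using w by (fastforce simp: Q_def threshold_def b_def)
  have "variable_ideal (A k) = {g. g * xpow b \<in> I}"
  proof (intro equalityI subsetI; clarify)
    fix g :: "('n, 'k) mpoly" assume g: "g \<in> variable_ideal (A k)"
    show "g * xpow b \<in> I"
      unfolding I' monomial_span_def
    proof clarify
      fix c j assume "c \<in> support (g * xpow b)" and j: "j \<in> T"
      then obtain u where u: "u \<in> support g" "c = (\<lambda>i. u i + b i)" by (auto elim: support_mult)
      show "c \<in> Q j"
      proof (cases "j = k")
        case True
        obtain i where "i \<in> A k" "1 \<le> u i" using g u(1) unfolding variable_ideal_eq monomial_span_def by blast
        then have "w k i \<le> c i" by (simp add: u(2) b_def)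
        then show ?thesis using \<open>i \<in> A k\<close> True by (auto simp: Q_def threshold_def)
      next
        case False
        then have "b \<in> Q j" using b j by blast
        then show ?thesis unfolding Q_def
          by (rule up_closedD[OF up_closed_threshold]) (simp add: u(2))
      qed
    qed
  next
    fix g :: "('n, 'k) mpoly" assume g: "g * xpow b \<in> I"
    show "g \<in> variable_ideal (A k)"
    proof (rule ccontr)
      assume "g \<notin> variable_ideal (A k)"
      then have "(xpow b :: ('n, 'k) mpoly) \<in> monomial_span (Q k)"
        unfolding variable_ideal_eq
      proof (rule monomial_span_primary[rotated 2])
        show "g * xpow b \<in> monomial_span (Q k)" using g k unfolding I' monomial_span_def by blast
        show "up_closed (Q k)" unfolding Q_def by (rule up_closed_threshold)
        show "v \<in> Q k" if "u \<in> Q k" "\<And>i. i \<in> A k \<Longrightarrow> u i = v i" for u v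
          using that unfolding Q_def threshold_def by auto
      qed
      then show False using bk by simp
    qed
  qed
  then show ?thesis unfolding associated_primes_def using prime_variable_ideal by blast
qed

text \<open>Otherwise each \<open>A j\<close> has a variable outside \<open>P\<close>. The product
  of suitable powers of these lies in \<open>I\<close>, hence annihilates \<open>f\<close> and lies
  in \<open>P\<close>, against primality.\<close>

lemma associated_prime_superset:
  fixes A :: "'i \<Rightarrow> 'n::{finite,linorder} set"
  assumes I: "I = (\<Inter>j\<in>T. irreducible_component (A j) (w j))" and fin: "finite T"
    and P: "P \<in> associated_primes (I :: ('n, 'k::field) mpoly set)"
  shows "\<exists>j\<in>T. variable_ideal (A j) \<subseteq> P"
proof (rule ccontr)
  assume no: "\<not> (\<exists>j\<in>T. variable_ideal (A j) \<subseteq> P)"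
  obtain f where f: "P = {g. g * f \<in> I}" and pP: "prime_ideal P"
    using P unfolding associated_primes_def by blast
  note Pid = prime_idealD(1)[OF pP]
  have "\<exists>i\<in>A j. var i \<notin> P" if j: "j \<in> T" for j
  proof (rule ccontr)
    assume "\<not> (\<exists>i\<in>A j. var i \<notin> P)"
    then have "(\<lambda>i. var i ^ 1) ` A j \<subseteq> P" by auto
    then have "variable_ideal (A j) \<subseteq> P"
      unfolding variable_ideal_def irreducible_component_def by (rule ideal_gen_least[OF Pid])
    then show False using no j by blast
  qed
  then obtain v where v: "\<And>j. j \<in> T \<Longrightarrow> v j \<in> A j" "\<And>j. j \<in> T \<Longrightarrow> (var (v j) :: ('n, 'k) mpoly) \<notin> P"
    by metis
  define h :: "('n, 'k) mpoly" where "h = (\<Prod>j\<in>T. var (v j) ^ w j (v j))"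
  have idI: "ideal I ring_of_type_algebra"
    unfolding I irreducible_component_threshold monomial_span_INT
    by (intro ideal_monomial_span up_closed_INT up_closed_threshold)
  have "h \<in> irreducible_component (A j) (w j)" if j: "j \<in> T" for j
  proof -
    have "var (v j) ^ w j (v j) \<in> (irreducible_component (A j) (w j) :: ('n, 'k) mpoly set)"
      unfolding irreducible_component_def by (rule subsetD[OF ideal_gen_superset]) (use v j in auto)
    moreover have "h = (\<Prod>j\<in>T - {j}. var (v j) ^ w j (v j)) * var (v j) ^ w j (v j)"
      unfolding h_def using fin j by (simp add: prod.remove mult.commute)
    ultimately show ?thesis
      unfolding irreducible_component_def using ideal_type_algebraD(3)[OF ideal_ideal_gen] by simp
  qed
  then have "h \<in> I" unfolding I by blast
  then have "f * h \<in> I" by (rule ideal_type_algebraD(3)[OF idI])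
  then have "h \<in> P" unfolding f by (simp add: mult.commute)
  moreover have "h \<notin> P"
    unfolding h_def by (intro prime_ideal_prod[OF pP fin] prime_ideal_power[OF pP] v)
  ultimately show False by simp
qed

context edge_weighting
begin

text \<open>Multiplying by a high power of the variables outside \<open>A j\<close>, which are units in the localization,
  moves every monomial of \<open>q\<^sub>j\<^sup>s\<close> into \<open>I\<^sup>s\<close>.\<close>

lemma power_set_threshold_shift:
  assumes j: "j \<in> T" and m: "\<And>k i. k \<in> T \<Longrightarrow> w k i \<le> m"
    and a: "a \<in> power_set (threshold (A j) (w j)) s"
  shows "(\<lambda>i. a i + (if i \<in> A j then 0 else s * m)) \<in> power_set covers s"
  using a
proof (induction s arbitrary: a)
  case (Suc s)
  then obtain b c where bc: "b \<in> power_set (threshold (A j) (w j)) s" "c \<in> threshold (A j) (w j)"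
    "\<forall>i. b i + c i \<le> a i" by auto
  have "(\<lambda>i. c i + (if i \<in> A j then 0 else m)) \<in> covers"
    unfolding covers_def
  proof
    fix k assume k: "k \<in> T"
    show "(\<lambda>i. c i + (if i \<in> A j then 0 else m)) \<in> threshold (A k) (w k)"
    proof (cases "k = j")
      case True
      then show ?thesis using bc(2) by (auto simp: threshold_def)
    next
      case False
      then obtain i where "i \<in> A k" "i \<notin> A j" using other_vertex[OF j k] by blast
      then show ?thesis using m[OF k, of i] by (auto simp: threshold_def intro!: bexI[of _ i])
    qed
  qed
  moreover have "\<forall>i. (b i + (if i \<in> A j then 0 else s * m)) + (c i + (if i \<in> A j then 0 else m))
      \<le> a i + (if i \<in> A j then 0 else Suc s * m)"
    using bc(3) by (simp add: algebra_simps)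
  ultimately show ?case
    unfolding power_set.simps mem_Collect_eq using Suc.IH[OF bc(1)] by (intro bexI)
qed simp

end

text \<open>In one direction a multiplier outside the prime is cancelled, as the power of the
  component is primary. In the other, the monomial \<open>xpow n\<close> from
  \<open>power_set_threshold_shift\<close> is a multiplier; it is free of the variables of
  \<open>A j\<close>.\<close>

lemma local_contraction_covers:
  fixes A :: "'i \<Rightarrow> 'n::{finite,linorder} set"
  assumes "edge_weighting T A w" and j: "j \<in> T"
  shows "local_contraction (variable_ideal (A j)) (monomial_span (power_set (edge_weighting.covers T A w) s))
    = (monomial_span (power_set (threshold (A j) (w j)) s) :: ('n, 'k::field) mpoly set)"
proof -
  interpret edge_weighting T A w by fact
  let ?P = "variable_ideal (A j) :: ('n, 'k) mpoly set"
  obtain m where m: "\<And>k i. k \<in> T \<Longrightarrow> w k i \<le> m" using weight_bound by blast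
  define n where "n i = (if i \<in> A j then 0 else s * m)" for i
  have "(\<exists>h. h \<notin> ?P \<and> h * f \<in> monomial_span (power_set covers s)) \<longleftrightarrow>
      f \<in> monomial_span (power_set (threshold (A j) (w j)) s)" for f :: "('n, 'k) mpoly"
  proof
    assume "\<exists>h. h \<notin> ?P \<and> h * f \<in> monomial_span (power_set covers s)"
    then obtain h where h: "h \<notin> ?P" "h * f \<in> monomial_span (power_set covers s)" by blast
    have "power_set covers s \<subseteq> power_set (threshold (A j) (w j)) s"
      using covers_power_subset j unfolding edgewise_power_def by blast
    then have "h * f \<in> monomial_span (power_set (threshold (A j) (w j)) s)"
      using h(2) monomial_span_mono by blast
    then show "f \<in> monomial_span (power_set (threshold (A j) (w j)) s)"
    proof (rule monomial_span_primary[rotated 3])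
      show "h \<notin> monomial_span {a. \<exists>i\<in>A j. 1 \<le> a i}"
        using h(1) unfolding variable_ideal_eq .
    qed (rule up_closed_power_set, rule power_set_threshold_cong)
  next
    assume f: "f \<in> monomial_span (power_set (threshold (A j) (w j)) s)"
    have "xpow n \<notin> ?P" by (auto simp: variable_ideal_eq n_def)
    moreover have "xpow n * f \<in> monomial_span (power_set covers s)"
      unfolding monomial_span_def
    proof clarify
      fix c assume "c \<in> support (xpow n * f)"
      then obtain b where "b \<in> support f" "c = (\<lambda>i. b i + n i)"
        by (auto elim!: support_mult simp: add.commute)
      then show "c \<in> power_set covers s"
        using power_set_threshold_shift[OF j m, of b s] f by (auto simp: monomial_span_def n_def)
    qed
    ultimately show "\<exists>h. h \<notin> ?P \<and> h * f \<in> monomial_span (power_set covers s)" by blast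
  qed
  then show ?thesis
    unfolding local_contraction_eq[OF prime_variable_ideal ideal_monomial_span[OF up_closed_power_set]]
    by blast
qed

theorem corollary4p10:
  fixes I :: "('n::{finite,linorder}, 'k::field) mpoly set"
    and r :: nat and A :: "nat \<Rightarrow> 'n set" and w :: "nat \<Rightarrow> 'n \<Rightarrow> nat"
  assumes "monomial_ideal I" and "I \<noteq> {0}" and "I \<noteq> UNIV"
    and "embedded_primes I = {}"
    and "minimal_irreducible_decomposition I r A w"
    and "\<forall>P \<in> associated_primes I. height P = 2"
  shows "(simis_ideal I \<longleftrightarrow> symbolic_power I 2 = ideal_power I 2) \<and>
    (symbolic_power I 2 = ideal_power I 2 \<longleftrightarrow>
      bipartite (UNIV :: 'n set) (A ` {1..r}) \<and> has_standard_linear_weighting I)"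
proof -
  let ?T = "{1..r}"
  have A: "A j \<noteq> {}" and w: "\<And>i. i \<in> A j \<Longrightarrow> 1 \<le> w j i" if "j \<in> ?T" for j
    using assms(5) that unfolding minimal_irreducible_decomposition_def by blast+
  have I: "I = (\<Inter>j\<in>?T. irreducible_component (A j) (w j))"
    and inj: "inj_on (\<lambda>j. radical (irreducible_component (A j) (w j) :: ('n, 'k) mpoly set)) ?T"
    and irr: "\<And>k. k \<in> ?T \<Longrightarrow> I \<noteq> (\<Inter>j\<in>?T - {k}. irreducible_component (A j) (w j))"
    using assms(5) unfolding minimal_irreducible_decomposition_def by blast+
  have var_ass: "variable_ideal (A k) \<in> associated_primes I" if "k \<in> ?T" for k
    by (rule variable_ideal_associated[OF I irr[OF that] that w[OF that]])
  \<comment> \<open>An associated prime contains one of the primes of the \<open>A j\<close>, which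
    is itself associated; without embedded primes the two coincide.\<close>
  have ass: "associated_primes I = (\<lambda>j. variable_ideal (A j)) ` ?T"
  proof (intro equalityI subsetI)
    fix P assume P: "P \<in> associated_primes I"
    then obtain j where j: "j \<in> ?T" "variable_ideal (A j) \<subseteq> P"
      using associated_prime_superset[OF I finite_atLeastAtMost] by blast
    have "\<not> variable_ideal (A j) \<subset> P"
      using assms(4) P var_ass[OF j(1)] unfolding embedded_primes_def by blast
    then show "P \<in> (\<lambda>j. variable_ideal (A j)) ` ?T" using j by blast
  qed (use var_ass in blast)
  \<comment> \<open>The chain of variables excludes three or more elements, and the bound for a
    single variable excludes one.\<close>
  have card: "card (A j) = 2" if j: "j \<in> ?T" for j
  proof -
    have ht: "height (variable_ideal (A j) :: ('n, 'k) mpoly set) = 2" using assms(6) var_ass[OF j] by blast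
    have "card (A j) \<noteq> 1"
    proof
      assume "card (A j) = 1"
      then obtain i where "A j = {i}" by (auto simp: card_1_singleton_iff)
      then show False
        using height_variable_ideal_singleton[of i, where 'k = 'k] ht by (simp add: one_enat_def numeral_eq_enat)
    qed
    moreover have "card (A j) \<le> 2"
      using card_le_height_variable_ideal[of "A j", where 'k = 'k] ht by (simp add: numeral_eq_enat)
    moreover have "card (A j) \<noteq> 0" using A[OF j] by simp
    ultimately show ?thesis by linarith
  qed
  \<comment> \<open>The radical of a component depends on \<open>A j\<close> alone, so distinct
    radicals force distinct edges.\<close>
  have "inj_on A ?T"
  proof (rule inj_onI)
    fix j k assume jk: "j \<in> ?T" "k \<in> ?T" "A j = A k"
    have "radical (irreducible_component (A j) (w j)) = (variable_ideal (A k) :: ('n, 'k) mpoly set)"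
      using radical_irreducible_component[of "A j" "w j", where 'k = 'k] w[OF jk(1)] jk(3) by auto
    moreover have "radical (irreducible_component (A k) (w k)) = (variable_ideal (A k) :: ('n, 'k) mpoly set)"
      by (rule radical_irreducible_component[OF w[OF jk(2)]])
    ultimately show "j = k" by (intro inj_onD[OF inj _ jk(1,2)]) simp
  qed
  then interpret edge_weighting ?T A w by unfold_locales (use card w in auto)
  have I_span: "I = monomial_span covers"
    unfolding I irreducible_component_threshold monomial_span_INT covers_def ..
  have ipow: "ideal_power I s = monomial_span (power_set covers s)" for s
    unfolding I_span covers_def
    by (intro ideal_power_monomial_span up_closed_INT up_closed_threshold)
  have spow: "symbolic_power I s = monomial_span (edgewise_power s)" for s
    unfolding symbolic_power_def ass ipow image_image edgewise_power_def monomial_span_INT[symmetric]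
    by (intro INF_cong refl) (rule local_contraction_covers[OF edge_weighting_axioms])
  have eq_iff: "symbolic_power I s = ideal_power I s \<longleftrightarrow> edgewise_power s \<subseteq> power_set covers s" for s
    unfolding ipow spow monomial_span_inject using covers_power_subset by blast
  have to_graph: "bipartite UNIV (A ` ?T) \<and> has_standard_linear_weighting I"
    if "symbolic_power I 2 = ideal_power I 2"
  proof -
    have eq: "edgewise_power 2 \<subseteq> power_set covers 2" using that unfolding eq_iff .
    obtain W where "\<And>i. 0 < W i" "\<And>j i. j \<in> ?T \<Longrightarrow> i \<in> A j \<Longrightarrow> w j i = W i"
      using vertex_weighting[OF eq] by blast
    then show ?thesis
      unfolding I_span has_standard_linear_weighting_iff using bipartite_of_power_2[OF eq] by blast
  qed
  have of_graph: "symbolic_power I s = ideal_power I s"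
    if bip: "bipartite UNIV (A ` ?T)" and std: "has_standard_linear_weighting I" for s
  proof -
    obtain W where "\<forall>j\<in>?T. \<forall>i\<in>A j. w j i = W i"
      using std unfolding I_span has_standard_linear_weighting_iff by blast
    then show ?thesis unfolding eq_iff by (intro edgewise_power_subset[OF _ bip]) blast
  qed
  have "simis_ideal I \<longleftrightarrow> (\<forall>s\<ge>1. symbolic_power I s = ideal_power I s)"
    unfolding simis_ideal_def using assms(1) by blast
  moreover have "(1 :: nat) \<le> 2" by simp
  ultimately show ?thesis using to_graph of_graph by blast
qed

end
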